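(* (i) Let $n\geqslant 4$ and let $p(z)=a_0z^n+a_1z^{n-1}+\dots+a_n$ be a real polynomial of degree $n$ with $a_0>0$, $a_n>0$. Suppose that $p$ has no zeros in the sector $$|\arg z|<\frac{\pi}{2}\cdot\frac{n-2}{n-1},$$ and that $p$ satisfies the reflection property: if $p(\lambda)=0$ for some $\lambda\in\mathbb{C}$ such that $\Re\lambda>0$, then $p(-\lambda)=0$. Then the finite Hurwitz matrix $\mathcal{H}_n(p)$ is totally nonnegative. The constant is sharp: for every $n\geqslant4$ and every $\beta<\frac{\pi}{2}\cdot\frac{n-2}{n-1}$ there is a real polynomial of degree $n$ with positive leading coefficient and positive constant term which has no zeros in the sector $|\arg z|<\beta$ and satisfies the reflection property, but whose finite Hurwitz matrix is not totally nonnegative. (ii) Let $1\leqslant n\leqslant 3$ and let $p(z)=a_0z^n+a_1z^{n-1}+\dots+a_n$ be a real polynomial of degree $n$ with $a_0>0$, $a_n>0$. Then $p$ is quasi-stable if and only if $\mathcal{H}_n(p)$ is totally nonnegative.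
   Context: For a real polynomial $p(z)=a_0z^n+a_1z^{n-1}+\dots+a_n$, put $a_k=0$ for $k<0$ and $k>n$. The finite Hurwitz matrix of $p$ is the $n\times n$ matrix $\mathcal{H}_n(p)=(a_{2j-i})_{i,j=1}^n$. A matrix is totally nonnegative if all its minors are nonnegative. A polynomial is quasi-stable if all its zeros lie in the closed left half-plane $\{\Re z\leqslant 0\}$. For $z\neq 0$, $\arg z\in(-\pi,\pi]$ is the principal argument.
   Formalization: The reflection property is required with multiplicity: each zero λ with Re λ > 0 is matched by the zero −λ of at least the same multiplicity; without this part (i) fails, e.g. for (z²−2sz+1)²(z²+2sz+1) with s = cos 80°. *)

theory Defs
  imports
    "HOL-Computational_Algebra.Polynomial"
    "Jordan_Normal_Form.Determinant"
    "Jordan_Normal_Form.DL_Submatrix"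
    Complex_Main
begin

(* Coefficients are numbered from the leading one, p(z) = a_0 z^n + ... + a_n with
   n = degree p, and a_k = 0 for k < 0 and k > n. *)
definition desc_coeff :: "real poly \<Rightarrow> int \<Rightarrow> real" where
  "desc_coeff p k =
     (if 0 \<le> k \<and> k \<le> int (degree p) then Polynomial.coeff p (degree p - nat k) else 0)"

(* Matrix indices start at 0, so the entry (i, j) is a_(2(j+1)-(i+1)). *)
definition finite_hurwitz_matrix :: "real poly \<Rightarrow> real mat" where
  "finite_hurwitz_matrix p =
     mat (degree p) (degree p) (\<lambda>(i, j). desc_coeff p (2 * (int j + 1) - (int i + 1)))"

definition totally_nonnegative :: "real mat \<Rightarrow> bool" where
  "totally_nonnegative A \<longleftrightarrow>
     (\<forall>I J. I \<subseteq> {..<dim_row A} \<and> J \<subseteq> {..<dim_col A} \<and> card I = card J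
        \<longrightarrow> 0 \<le> det (submatrix A I J))"

abbreviation complex_poly :: "real poly \<Rightarrow> complex poly" where
  "complex_poly p \<equiv> map_poly complex_of_real p"

definition quasi_stable :: "real poly \<Rightarrow> bool" where
  "quasi_stable p \<longleftrightarrow> (\<forall>z. poly (complex_poly p) z = 0 \<longrightarrow> Re z \<le> 0)"

definition no_zeros_in_sector :: "real poly \<Rightarrow> real \<Rightarrow> bool" where
  "no_zeros_in_sector p \<beta> \<longleftrightarrow>
     (\<forall>z. z \<noteq> 0 \<and> \<bar>Arg z\<bar> < \<beta> \<longrightarrow> poly (complex_poly p) z \<noteq> 0)"

(* Zeros are counted with multiplicity: a zero l with Re l > 0 is matched by the zero -l of at
   least the same multiplicity.  Disregarding multiplicities would not do: for small s > 0 the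
   polynomial (z^2 - 2sz + 1)^2 (z^2 + 2sz + 1) has the zero -l for each zero l, but its
   coefficient a_1 = -2s, an entry of the Hurwitz matrix, is negative. *)
definition reflection_property :: "real poly \<Rightarrow> bool" where
  "reflection_property p \<longleftrightarrow>
     (\<forall>l. Re l > 0 \<longrightarrow>
        Polynomial.order l (complex_poly p) \<le> Polynomial.order (- l) (complex_poly p))"

end

theory Submission
  imports Defs "Jordan_Normal_Form.Char_Poly"
begin

text \<open>
  Let n be the degree of p. By the reflection property, the zeros of p in the closed right
  half-plane and their negatives make up an even factor, so p(z) = g(z^2) q(z) with all zeros of q
  in the open left half-plane (\<open>even_factor_splitting\<close>). In terms of matrices, the Hurwitz matrix
  of p is a product of a Hurwitz-type matrix of q and n - d rows of the Toeplitz matrix of g, where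
  d is the degree of g. The two factors are treated separately.

  The Toeplitz matrix of g: a zero of p on the imaginary axis contributes a factor w + a
  with a > 0 to g(w), that is, a bidiagonal matrix. A zero in the open right half-plane
  contributes w^2 + 2 \<rho> cos \<theta> w + \<rho>^2, and the sector condition says (n - 1) \<theta> \<le> \<pi>. The
  corresponding matrix with three diagonals is not totally nonnegative, but its first k rows are a
  product of nonnegative bidiagonal matrices with entries built from sin (i \<theta>) as long as
  (k + 1) \<theta> \<le> \<pi> (\<open>tn_rows_quadratic_factor\<close>). Such a factor has degree 2, so at most n - 2
  rows are needed, and this is why the constant involves n - 1.

  The stable factor q: one step of the Routh algorithm expresses each row of the Hurwitz
  matrix as a nonnegative combination of two consecutive rows of the Hurwitz matrix of the reduced
  polynomial (\<open>hurwitz_entry_routh_step\<close>). That the reduced polynomial is again stable follows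
  from a Cauchy-Schwarz estimate for a telescoping sum over the zeros
  (\<open>telescoped_modulus_bound\<close>, \<open>hurwitz_stable_routh_step\<close>).

  All these matrix factors are nonnegative and bidiagonal, up to repeated or inserted zero rows, so
  multilinearity of the determinant in its rows suffices to carry nonnegativity of minors from one
  matrix to the next (\<open>minor_row_combination_lower_bound\<close>).

  For the sharpness take p(z) = (z^4 + 2 cos \<theta> z^2 + 1) (z + 1)^(n - 4) with \<theta> slightly larger
  than \<pi> / (n - 1). Some minor of order n - 2 is the product of a positive minor for
  (z + 1)^(n - 4) and of the tridiagonal determinant sin ((n - 1) \<theta>) / sin \<theta> < 0.

  In degrees 1 to 3 a quasi-stable polynomial falls under the same argument, with no zeros in the
  open right half-plane. Conversely the entries of the matrix and one minor of order 2 give the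
  classical inequalities that exclude zeros with positive real part
  (\<open>totally_nonnegative_imp_quasi_stable\<close>).
\<close>

section \<open>Minors and row combinations\<close>

text \<open>Rows and columns are selected by functions rather than by sets, because expanding a minor by
  multilinearity produces selections that are only weakly increasing.\<close>

definition minor :: "(nat \<Rightarrow> nat \<Rightarrow> real) \<Rightarrow> nat \<Rightarrow> (nat \<Rightarrow> nat) \<Rightarrow> (nat \<Rightarrow> nat) \<Rightarrow> real" where
  "minor M r f g = det (mat r r (\<lambda>(a, b). M (f a) (g b)))"

text \<open>Infinite matrices in which all minors taken from the first R rows, with any choice of columns, are
  nonnegative. All factorizations below multiply from the left, so only the rows have to be
  bounded; the bound is what the zeros outside the closed left half-plane restrict.\<close>

definition tn_rows :: "nat \<Rightarrow> (nat \<Rightarrow> nat \<Rightarrow> real) \<Rightarrow> bool" where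
  "tn_rows R M \<longleftrightarrow> (\<forall>r f g. strict_mono_on {..<r} f \<longrightarrow> strict_mono_on {..<r} g \<longrightarrow>
     f ` {..<r} \<subseteq> {..<R} \<longrightarrow> 0 \<le> minor M r f g)"

lemma tn_rowsD:
  "tn_rows R M \<Longrightarrow> strict_mono_on {..<r} f \<Longrightarrow> strict_mono_on {..<r} g \<Longrightarrow>
    f ` {..<r} \<subseteq> {..<R} \<Longrightarrow> 0 \<le> minor M r f g"
  by (simp only: tn_rows_def)

lemma minor_cong:
  assumes "\<And>a b. a < r \<Longrightarrow> b < r \<Longrightarrow> M (f a) (g b) = M' (f' a) (g' b)"
  shows "minor M r f g = minor M' r f' g'"
  unfolding minor_def using assms by (auto intro!: arg_cong[of _ _ det] eq_matI)

lemma tn_rows_mono: "tn_rows R M \<Longrightarrow> R' \<le> R \<Longrightarrow> tn_rows R' M"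
  unfolding tn_rows_def by (meson lessThan_subset_iff order_trans)

lemma minor_weakly_increasing_nonneg:
  assumes tn: "tn_rows R M" and f: "mono_on {..<r} f" "f ` {..<r} \<subseteq> {..<R}"
    and g: "strict_mono_on {..<r} g"
  shows "0 \<le> minor M r f g"
proof (cases "inj_on f {..<r}")
  case True
  then have "strict_mono_on {..<r} f"
    using f(1) by (auto simp: strict_mono_on_def mono_on_def inj_on_def le_less)
  then show ?thesis using tn f(2) g unfolding tn_rows_def by blast
next
  case False
  then obtain a b where ab: "a < r" "b < r" "a \<noteq> b" "f a = f b" by (auto simp: inj_on_def)
  have "minor M r f g = 0" unfolding minor_def
    by (rule det_identical_rows[of _ r a b]) (use ab in \<open>auto intro!: eq_vecI\<close>)
  then show ?thesis by simp
qed

lemma det_combination_of_row: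
  assumes k: "k < r"
    and A: "\<And>b. b < r \<Longrightarrow> A k b = s * B k b + t * C k b"
    and other: "\<And>a b. a < r \<Longrightarrow> b < r \<Longrightarrow> a \<noteq> k \<Longrightarrow> A a b = B a b \<and> A a b = C a b"
  shows "det (mat r r (\<lambda>(a, b). A a b :: real)) =
    s * det (mat r r (\<lambda>(a, b). B a b)) + t * det (mat r r (\<lambda>(a, b). C a b))"
proof -
  have split: "(\<Prod>i = 0..<r. D i (p i)) = D k (p k) * (\<Prod>i \<in> {0..<r} - {k}. D i (p i))"
    for D :: "nat \<Rightarrow> nat \<Rightarrow> real" and p using k by (intro prod.remove) auto
  have "signof p * (\<Prod>i = 0..<r. A i (p i)) =
      s * (signof p * (\<Prod>i = 0..<r. B i (p i))) + t * (signof p * (\<Prod>i = 0..<r. C i (p i)))"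
    if p: "p permutes {0..<r}" for p
  proof -
    have lt: "p i < r" if "i < r" for i using permutes_in_image[OF p, of i] that by simp
    have B: "(\<Prod>i \<in> {0..<r} - {k}. A i (p i)) = (\<Prod>i \<in> {0..<r} - {k}. B i (p i))"
      using other lt by (intro prod.cong) auto
    have C: "(\<Prod>i \<in> {0..<r} - {k}. C i (p i)) = (\<Prod>i \<in> {0..<r} - {k}. B i (p i))"
      using other lt by (intro prod.cong) (auto, metis)
    show ?thesis unfolding split[of A] split[of B] split[of C] B C A[OF lt[OF k]]
      by (simp add: algebra_simps)
  qed
  moreover have "det (mat r r (\<lambda>(a, b). D a b)) =
      (\<Sum>p | p permutes {0..<r}. signof p * (\<Prod>i = 0..<r. D i (p i)))"
    for D :: "nat \<Rightarrow> nat \<Rightarrow> real"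
    by (subst det_def'[of _ r]) (auto intro!: sum.cong prod.cong
        simp: permutes_in_image atLeast0LessThan)
  ultimately show ?thesis by (simp add: sum.distrib sum_distrib_left)
qed

text \<open>This replaces the Cauchy-Binet formula. Each row of M' is a nonnegative combination of two rows of
  M, and the rows used for a later row of M' never precede those used for an earlier one. Expanding
  a minor of M' row by row gives a sum of minors of M with weakly increasing row selections, none of
  which is negative. Hence any single term, chosen by c, is a lower bound; the terms are kept
  because strict positivity is needed for the sharpness of the sector.\<close>

lemma minor_row_combination_lower_bound:
  assumes tn: "tn_rows R M"
    and f: "strict_mono_on {..<r} f" "f ` {..<r} \<subseteq> {..<R'}"
    and g: "strict_mono_on {..<r} g"
    and uv: "\<And>i. i < R' \<Longrightarrow> u i \<le> v i \<and> v i < R"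
    and vu: "\<And>i i'. i < i' \<Longrightarrow> i' < R' \<Longrightarrow> v i \<le> u i'"
    and st: "\<And>i. i < R' \<Longrightarrow> 0 \<le> s i \<and> 0 \<le> t i"
    and M': "\<And>i j. i < R' \<Longrightarrow> M' i j = s i * M (u i) j + t i * M (v i) j"
  shows "(\<Prod>a<r. if c a then s (f a) else t (f a)) *
      minor M r (\<lambda>a. if c a then u (f a) else v (f a)) g \<le> minor M' r f g"
proof -
  define pick_row where "pick_row c a = (if c a then u (f a) else v (f a))" for c a
  \<comment> \<open>Interpolates between a minor of M and the minor of M': the first k rows are still
    unexpanded, the others have been replaced by the selected rows of M.\<close>
  define expanded where
    "expanded k c a b = (if a < k then M' (f a) (g b) else M (pick_row c a) (g b))" for k c a b
  define coef where "coef c a = (if c a then s (f a) else t (f a))" for c a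
  have fR: "f a < R'" if "a < r" for a using f(2) that by auto
  have base: "0 \<le> minor M r (pick_row c) g" for c
  proof (rule minor_weakly_increasing_nonneg[OF tn _ _ g])
    show "mono_on {..<r} (pick_row c)"
    proof (rule mono_onI)
      fix a b assume ab: "a \<in> {..<r}" "b \<in> {..<r}" "a \<le> b"
      show "pick_row c a \<le> pick_row c b"
      proof (cases "a = b")
        case False
        then have "f a < f b" using f(1) ab by (auto simp: strict_mono_on_def)
        then have "v (f a) \<le> u (f b)" using vu fR ab by auto
        then show ?thesis using uv[OF fR, of a] uv[OF fR, of b] ab unfolding pick_row_def by auto
      qed simp
    qed
    show "pick_row c ` {..<r} \<subseteq> {..<R}"
      using uv fR unfolding pick_row_def by (fastforce split: if_splits)
  qed
  have bound: "k \<le> r \<Longrightarrow> 0 \<le> (\<Prod>a<k. coef c a) * minor M r (pick_row c) g \<and>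
      (\<Prod>a<k. coef c a) * minor M r (pick_row c) g
        \<le> det (mat r r (\<lambda>(a, b). expanded k c a b))" for k c
  proof (induction k arbitrary: c)
    case 0
    have "det (mat r r (\<lambda>(a, b). expanded 0 c a b)) = minor M r (pick_row c) g"
      unfolding minor_def expanded_def by simp
    then show ?case using base[of c] by simp
  next
    case (Suc k)
    define cs where "cs = c(k := True)"
    define ct where "ct = c(k := False)"
    have k: "k < r" using Suc.prems by simp
    have eq: "det (mat r r (\<lambda>(a, b). expanded (Suc k) c a b)) =
      s (f k) * det (mat r r (\<lambda>(a, b). expanded k cs a b)) +
      t (f k) * det (mat r r (\<lambda>(a, b). expanded k ct a b))"
      by (rule det_combination_of_row[OF k])
        (use M' fR k in \<open>auto simp: expanded_def pick_row_def cs_def ct_def\<close>)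
    have nn: "0 \<le> s (f k)" "0 \<le> t (f k)" using st[OF fR[OF k]] by auto
    have pos: "0 \<le> det (mat r r (\<lambda>(a, b). expanded k c' a b))" for c'
      using Suc.IH[of c'] Suc.prems by auto
    have "coef c k * det (mat r r (\<lambda>(a, b). expanded k c a b))
        \<le> det (mat r r (\<lambda>(a, b). expanded (Suc k) c a b))"
    proof (cases "c k")
      case True
      then have "cs = c" unfolding cs_def by (auto simp: fun_eq_iff)
      then show ?thesis using eq True nn pos[of ct] by (simp add: coef_def)
    next
      case False
      then have "ct = c" unfolding ct_def by (auto simp: fun_eq_iff)
      then show ?thesis using eq False nn pos[of cs] by (simp add: coef_def)
    qed
    moreover have c: "0 \<le> coef c k" using nn by (simp add: coef_def)
    moreover have IH: "0 \<le> (\<Prod>a<k. coef c a) * minor M r (pick_row c) g"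
      "(\<Prod>a<k. coef c a) * minor M r (pick_row c) g
        \<le> det (mat r r (\<lambda>(a, b). expanded k c a b))" using Suc.IH[of c] Suc.prems by auto
    moreover have "coef c k * ((\<Prod>a<k. coef c a) * minor M r (pick_row c) g)
        \<le> coef c k * det (mat r r (\<lambda>(a, b). expanded k c a b))"
      using IH(2) c by (rule mult_left_mono)
    moreover have "0 \<le> coef c k * ((\<Prod>a<k. coef c a) * minor M r (pick_row c) g)"
      using IH(1) c by simp
    ultimately show ?case by (simp add: mult_ac)
  qed
  have "det (mat r r (\<lambda>(a, b). expanded r c a b)) = minor M' r f g"
    unfolding minor_def expanded_def by (auto intro!: arg_cong[of _ _ det] eq_matI)
  then show ?thesis using bound[of r c] unfolding coef_def pick_row_def by simp
qed

lemma tn_rows_row_combination: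
  assumes tn: "tn_rows R M"
    and uv: "\<And>i. i < R' \<Longrightarrow> u i \<le> v i \<and> v i < R"
    and vu: "\<And>i i'. i < i' \<Longrightarrow> i' < R' \<Longrightarrow> v i \<le> u i'"
    and st: "\<And>i. i < R' \<Longrightarrow> 0 \<le> s i \<and> 0 \<le> t i"
    and M': "\<And>i j. i < R' \<Longrightarrow> M' i j = s i * M (u i) j + t i * M (v i) j"
  shows "tn_rows R' M'"
  unfolding tn_rows_def
proof (intro allI impI)
  fix r and f g :: "nat \<Rightarrow> nat"
  assume f: "strict_mono_on {..<r} f" "f ` {..<r} \<subseteq> {..<R'}" and g: "strict_mono_on {..<r} g"
  let ?P = "\<Prod>a<r. t (f a)"
  have fR: "f a < R'" if "a < r" for a using f(2) that by auto
  have "?P * minor M r (\<lambda>a. v (f a)) g \<le> minor M' r f g"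
    using minor_row_combination_lower_bound[OF tn f g uv vu st M', where c = "\<lambda>_. False"] by simp
  moreover have "0 \<le> ?P" using st fR by (intro prod_nonneg) auto
  moreover have "0 \<le> minor M r (\<lambda>a. v (f a)) g"
  proof (rule minor_weakly_increasing_nonneg[OF tn _ _ g])
    show "mono_on {..<r} (\<lambda>a. v (f a))"
    proof (rule mono_onI)
      fix a b assume ab: "a \<in> {..<r}" "b \<in> {..<r}" "a \<le> b"
      show "v (f a) \<le> v (f b)"
      proof (cases "a = b")
        case False
        then have "f a < f b" using f(1) ab by (auto simp: strict_mono_on_def)
        then show ?thesis using vu[OF _ fR, of "f a" b] uv[OF fR, of b] ab by auto
      qed simp
    qed
  qed (use uv fR in auto)
  ultimately show "0 \<le> minor M' r f g" by (meson mult_nonneg_nonneg order_trans)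
qed

lemma minor_eq_det_product:
  assumes "\<And>a b. a < r \<Longrightarrow> b < r \<Longrightarrow> M (f a) (g b) = (\<Sum>c<r. A a c * B c b)"
  shows "minor M r f g = det (mat r r (\<lambda>(a, b). A a b)) * det (mat r r (\<lambda>(a, b). B a b))"
proof -
  have "mat r r (\<lambda>(a, b). M (f a) (g b)) = mat r r (\<lambda>(a, b). A a b) * mat r r (\<lambda>(a, b). B a b)"
    using assms by (intro eq_matI) (auto simp: scalar_prod_def atLeast0LessThan)
  then show ?thesis unfolding minor_def by (simp add: det_mult[of _ r])
qed

lemma strict_mono_on_unique:
  fixes f g :: "nat \<Rightarrow> nat"
  assumes f: "strict_mono_on {..<r} f" and g: "strict_mono_on {..<r} g"
    and img: "f ` {..<r} = g ` {..<r}" and a: "a < r"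
  shows "f a = g a"
proof -
  have inj: "inj_on f {..<r}" "inj_on g {..<r}"
    using f g by (auto intro: strict_mono_on_imp_inj_on)
  have "sorted (map f [0..<r])" "sorted (map g [0..<r])"
    using f g by (auto simp: sorted_iff_nth_mono strict_mono_on_def le_less)
  with inj img have "map f [0..<r] = map g [0..<r]"
    by (intro sorted_distinct_set_unique) (auto simp: distinct_map atLeast0LessThan)
  then show ?thesis using a by (auto simp: map_eq_conv)
qed

lemma identity_tn_rows: "tn_rows R (\<lambda>i j. if j = i then 1 else 0)"
  unfolding tn_rows_def
proof (intro allI impI)
  fix r and f g :: "nat \<Rightarrow> nat"
  assume f: "strict_mono_on {..<r} f" and g: "strict_mono_on {..<r} g"
  let ?I = "\<lambda>i j :: nat. if j = i then 1 else 0 :: real"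
  show "0 \<le> minor ?I r f g"
  proof (cases "f ` {..<r} \<subseteq> g ` {..<r}")
    case True
    have inj: "inj_on f {..<r}" "inj_on g {..<r}"
      using f g by (auto intro: strict_mono_on_imp_inj_on)
    then have "f ` {..<r} = g ` {..<r}"
      using True by (intro card_subset_eq) (auto simp: card_image)
    then have fg: "f a = g a" if "a < r" for a
      using strict_mono_on_unique[OF f g _ that] by simp
    have "mat r r (\<lambda>(a, b). ?I (f a) (g b)) = 1\<^sub>m r"
      using inj(2) by (intro eq_matI) (auto simp: fg inj_on_def)
    then show ?thesis unfolding minor_def by simp
  next
    case False
    then obtain k where k: "k < r" "f k \<notin> g ` {..<r}" by auto
    \<comment> \<open>Row k is zero, so linearity in it applies with both coefficients 0.\<close>
    have "minor ?I r f g = 0 * minor ?I r f g + 0 * minor ?I r f g"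
      unfolding minor_def by (rule det_combination_of_row[OF k(1)]) (use k(2) in force)+
    then show ?thesis by simp
  qed
qed


section \<open>Hurwitz and Toeplitz entries of a polynomial\<close>

text \<open>Coefficients with integer index: multiplication by the variable becomes a shift, with no case
  distinction at the ends.\<close>

definition int_coeff :: "real poly \<Rightarrow> int \<Rightarrow> real" where
  "int_coeff p k = (if k < 0 then 0 else Polynomial.coeff p (nat k))"

lemma int_coeff_neg: "k < 0 \<Longrightarrow> int_coeff p k = 0"
  by (simp add: int_coeff_def)

lemma int_coeff_add [simp]: "int_coeff (p + q) k = int_coeff p k + int_coeff q k"
  and int_coeff_smult [simp]: "int_coeff (Polynomial.smult c p) k = c * int_coeff p k"
  and int_coeff_pCons_0 [simp]: "int_coeff (pCons 0 p) k = int_coeff p (k - 1)"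
  by (auto simp: int_coeff_def coeff_pCons nat_diff_distrib split: nat.splits)

lemma int_coeff_eq_0: "int (degree p) < k \<Longrightarrow> int_coeff p k = 0"
  by (auto simp: int_coeff_def intro!: coeff_eq_0)

text \<open>Entry (i, j) is the coefficient of index j - i counted from the leading one, so that
  multiplying g by a monic factor adds multiples of later rows to row i.\<close>

definition toeplitz_entry :: "real poly \<Rightarrow> nat \<Rightarrow> nat \<Rightarrow> real" where
  "toeplitz_entry g i j = int_coeff g (int (degree g) + int i - int j)"

text \<open>The Hurwitz matrix extended to infinitely many rows and columns, with indices from 0. The extra
  rows are needed since the Routh step below refers to the next row.\<close>

definition hurwitz_entry :: "real poly \<Rightarrow> nat \<Rightarrow> nat \<Rightarrow> real" where
  "hurwitz_entry p i j = int_coeff p (int (degree p) + int i - 1 - 2 * int j)"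

lemma dim_finite_hurwitz_matrix [simp]:
  "dim_row (finite_hurwitz_matrix p) = degree p" "dim_col (finite_hurwitz_matrix p) = degree p"
  by (simp_all add: finite_hurwitz_matrix_def)

lemma finite_hurwitz_matrix_entry:
  assumes "i < degree p" "j < degree p"
  shows "finite_hurwitz_matrix p $$ (i, j) = hurwitz_entry p i j"
proof -
  have "desc_coeff p k = int_coeff p (int (degree p) - k)" for k
    by (auto simp: desc_coeff_def int_coeff_def nat_diff_distrib intro!: coeff_eq_0)
  then show ?thesis using assms
    by (simp add: finite_hurwitz_matrix_def hurwitz_entry_def algebra_simps)
qed

lemma pick_subset:
  assumes "I \<subseteq> {..<n}" "card I = r"
  shows "strict_mono_on {..<r} (pick I)" "pick I ` {..<r} = I"
proof -
  show mono: "strict_mono_on {..<r} (pick I)"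
    using assms by (auto simp: strict_mono_on_def intro: pick_mono_le)
  show "pick I ` {..<r} = I"
  proof (rule card_subset_eq)
    show "card (pick I ` {..<r}) = card I"
      using assms(2) strict_mono_on_imp_inj_on[OF mono] by (simp add: card_image)
  qed (use assms pick_in_set_le in \<open>auto intro: finite_subset\<close>)
qed

lemma det_submatrix_eq_minor:
  assumes "I \<subseteq> {..<degree p}" "J \<subseteq> {..<degree p}" "card I = r" "card J = r"
  shows "det (submatrix (finite_hurwitz_matrix p) I J) =
    minor (hurwitz_entry p) r (pick I) (pick J)"
proof -
  have eq: "{i. i < degree p \<and> i \<in> I} = I" "{i. i < degree p \<and> i \<in> J} = J"
    using assms by auto
  have lt: "a < r \<Longrightarrow> pick I a < degree p" "a < r \<Longrightarrow> pick J a < degree p" for a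
    using assms pick_in_set_le[of a I] pick_in_set_le[of a J] by auto
  show ?thesis unfolding minor_def submatrix_def using lt
    by (auto simp: eq assms finite_hurwitz_matrix_entry intro!: arg_cong[of _ _ det] eq_matI)
qed

lemma totally_nonnegative_iff_minors:
  "totally_nonnegative (finite_hurwitz_matrix p) \<longleftrightarrow>
     (\<forall>r f g. strict_mono_on {..<r} f \<longrightarrow> strict_mono_on {..<r} g \<longrightarrow>
       f ` {..<r} \<subseteq> {..<degree p} \<longrightarrow> g ` {..<r} \<subseteq> {..<degree p} \<longrightarrow>
       0 \<le> minor (hurwitz_entry p) r f g)" (is "?L \<longleftrightarrow> ?R")
proof
  assume L: ?L
  show ?R
  proof (intro allI impI)
    fix r and f g :: "nat \<Rightarrow> nat"
    assume fg: "strict_mono_on {..<r} f" "strict_mono_on {..<r} g"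
      "f ` {..<r} \<subseteq> {..<degree p}" "g ` {..<r} \<subseteq> {..<degree p}"
    let ?I = "f ` {..<r}" and ?J = "g ` {..<r}"
    have card: "card ?I = r" "card ?J = r"
      using fg by (auto dest: strict_mono_on_imp_inj_on simp: card_image)
    have pf: "pick ?I a = f a" if "a < r" for a
      by (rule strict_mono_on_unique[of r, OF _ fg(1) _ that])
        (use pick_subset[OF fg(3) card(1)] in auto)
    have pg: "pick ?J a = g a" if "a < r" for a
      by (rule strict_mono_on_unique[of r, OF _ fg(2) _ that])
        (use pick_subset[OF fg(4) card(2)] in auto)
    have "0 \<le> det (submatrix (finite_hurwitz_matrix p) ?I ?J)"
      using L fg(3,4) card unfolding totally_nonnegative_def by simp
    also have "\<dots> = minor (hurwitz_entry p) r (pick ?I) (pick ?J)"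
      by (rule det_submatrix_eq_minor) (use fg card in auto)
    also have "\<dots> = minor (hurwitz_entry p) r f g"
      by (rule minor_cong) (simp add: pf pg)
    finally show "0 \<le> minor (hurwitz_entry p) r f g" .
  qed
next
  assume R: ?R
  show ?L unfolding totally_nonnegative_def dim_finite_hurwitz_matrix
  proof (intro allI impI, elim conjE)
    fix I J assume IJ: "I \<subseteq> {..<degree p}" "J \<subseteq> {..<degree p}" "card I = card J"
    have "0 \<le> minor (hurwitz_entry p) (card I) (pick I) (pick J)"
      using R pick_subset[OF IJ(1) refl] pick_subset[OF IJ(2) IJ(3)[symmetric]] IJ by auto
    then show "0 \<le> det (submatrix (finite_hurwitz_matrix p) I J)"
      using det_submatrix_eq_minor[OF IJ(1,2) refl IJ(3)[symmetric]] by simp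
  qed
qed

lemma totally_nonnegative_if_tn_rows:
  "tn_rows (degree p) (hurwitz_entry p) \<Longrightarrow> totally_nonnegative (finite_hurwitz_matrix p)"
  unfolding totally_nonnegative_iff_minors by (intro allI impI) (rule tn_rowsD)

section \<open>Toeplitz matrices of polynomials with zeros near the negative axis\<close>

lemma degree_linear_times:
  fixes g :: "real poly"
  assumes "g \<noteq> 0"
  shows "degree ([:a, 1:] * g) = degree g + 1" "degree ([:b, a, 1:] * g) = degree g + 2"
  by (subst degree_mult_eq; use assms in simp)+

lemma toeplitz_entry_linear_factor:
  assumes "g \<noteq> 0"
  shows "toeplitz_entry ([:a, 1:] * g) i j = toeplitz_entry g i j + a * toeplitz_entry g (i + 1) j"
proof -
  note degree_linear_times(1)[OF assms, of a]
  moreover have "[:a, 1:] * g = Polynomial.smult a g + pCons 0 g" by simp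
  ultimately show ?thesis
    unfolding toeplitz_entry_def
    by (simp only: int_coeff_add int_coeff_smult int_coeff_pCons_0) (simp add: algebra_simps)
qed

lemma toeplitz_entry_quadratic_factor:
  assumes "g \<noteq> 0"
  shows "toeplitz_entry ([:b, a, 1:] * g) i j =
    toeplitz_entry g i j + a * toeplitz_entry g (i + 1) j + b * toeplitz_entry g (i + 2) j"
proof -
  note degree_linear_times(2)[OF assms, of b a]
  moreover have "[:b, a, 1:] * g =
      Polynomial.smult b g + pCons 0 (Polynomial.smult a g + pCons 0 g)" by simp
  ultimately show ?thesis
    unfolding toeplitz_entry_def
    by (simp only: int_coeff_add int_coeff_smult int_coeff_pCons_0) (simp add: algebra_simps)
qed

lemma tn_rows_linear_factor:
  assumes "tn_rows (k + 1) M" "0 \<le> a"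
    and "\<And>i j. M' i j = M i j + a * M (i + 1) j"
  shows "tn_rows k M'"
  by (rule tn_rows_row_combination[OF assms(1), where u = "\<lambda>i. i" and v = "\<lambda>i. i + 1"
        and s = "\<lambda>_. 1" and t = "\<lambda>_. a"]) (use assms in auto)

text \<open>A conjugate pair of zeros -\<rho> exp(\<plusminus>i\<theta>) of g gives a band matrix with three diagonals, which is the
  product of two bidiagonal matrices depending on the row: with S i = sin (i \<theta>), the sum
  S i + S (i + 2) equals 2 cos \<theta> S (i + 1). The entries of both factors are nonnegative for k rows
  exactly as long as S stays nonnegative up to k + 1. The divisor S (i + 1) is kept in the left
  factor only, so that the boundary case S (k + 1) = 0 is covered.\<close>

lemma tn_rows_quadratic_factor:
  assumes tn: "tn_rows (k + 2) M" and th: "0 < \<theta>" "(real k + 1) * \<theta> \<le> pi" and \<rho>: "0 \<le> \<rho>"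
    and M': "\<And>i j. M' i j = M i j + 2 * \<rho> * cos \<theta> * M (i + 1) j + \<rho>\<^sup>2 * M (i + 2) j"
  shows "tn_rows k M'"
proof -
  define S where "S i = sin (real i * \<theta>)" for i :: nat
  define Y where "Y i j = S (i + 1) * M i j + \<rho> * S i * M (i + 1) j" for i j
  have nn: "0 \<le> S i" if "i \<le> k + 1" for i
  proof -
    have "real i * \<theta> \<le> (real k + 1) * \<theta>" using that th by (intro mult_right_mono) auto
    then have "real i * \<theta> \<le> pi" using th by linarith
    then show ?thesis unfolding S_def using th by (intro sin_ge_zero) auto
  qed
  have pos: "0 < S (i + 1)" if "i < k" for i
  proof -
    have "real (i + 1) * \<theta> < (real k + 1) * \<theta>" using that th by (intro mult_strict_right_mono) auto
    then have "real (i + 1) * \<theta> < pi" using th by linarith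
    then show ?thesis unfolding S_def using th by (intro sin_gt_zero) auto
  qed
  have Y: "tn_rows (k + 1) Y"
    by (rule tn_rows_row_combination[OF tn, where u = "\<lambda>i. i" and v = "\<lambda>i. i + 1"
          and s = "\<lambda>i. S (i + 1)" and t = "\<lambda>i. \<rho> * S i"]) (use nn \<rho> in \<open>auto simp: Y_def\<close>)
  show ?thesis
  proof (rule tn_rows_row_combination[OF Y, where u = "\<lambda>i. i" and v = "\<lambda>i. i + 1"
        and s = "\<lambda>i. 1 / S (i + 1)" and t = "\<lambda>i. \<rho> / S (i + 1)"])
    fix i j assume i: "i < k"
    have "S i + S (i + 2) = 2 * cos \<theta> * S (i + 1)"
    proof -
      have "real i * \<theta> = real (i + 1) * \<theta> - \<theta>" "real (i + 2) * \<theta> = real (i + 1) * \<theta> + \<theta>"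
        by (simp_all add: algebra_simps)
      then show ?thesis unfolding S_def by (simp only: sin_add sin_diff) (simp add: algebra_simps)
    qed
    then have *: "S (i + 1 + 1) = 2 * cos \<theta> * S (i + 1) - S i" by simp
    have "M' i j * S (i + 1) = Y i j + \<rho> * Y (i + 1) j"
      unfolding M' Y_def * by (simp add: algebra_simps power2_eq_square)
    then show "M' i j = 1 / S (i + 1) * Y i j + \<rho> / S (i + 1) * Y (i + 1) j"
      using pos[OF i] by (simp add: field_simps)
  qed (use nn pos \<rho> in \<open>auto simp: less_imp_le\<close>)
qed

lemma toeplitz_entry_1: "toeplitz_entry 1 = (\<lambda>i j. if j = i then 1 else 0)"
  by (auto simp: toeplitz_entry_def int_coeff_def fun_eq_iff nat_eq_iff)

text \<open>Products of factors whose zeros are at an angle of at most \<pi> / (N - 1) from the negative real axis.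
  The angle condition is multiplied out because N may be 1.\<close>

inductive wedge_poly :: "nat \<Rightarrow> real poly \<Rightarrow> bool" for N where
  one: "wedge_poly N 1"
| linear: "wedge_poly N g \<Longrightarrow> 0 \<le> a \<Longrightarrow> wedge_poly N ([:a, 1:] * g)"
| quadratic: "wedge_poly N g \<Longrightarrow> 0 \<le> \<rho> \<Longrightarrow> 0 < \<theta> \<Longrightarrow> (real N - 1) * \<theta> \<le> pi \<Longrightarrow>
    wedge_poly N ([:\<rho>\<^sup>2, 2 * \<rho> * cos \<theta>, 1:] * g)"

lemma wedge_poly_monic: "wedge_poly N g \<Longrightarrow> lead_coeff g = 1"
  by (induction rule: wedge_poly.induct) (auto simp: lead_coeff_mult simp del: mult_pCons_left)

lemma wedge_poly_nonzero: "wedge_poly N g \<Longrightarrow> g \<noteq> 0"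
  using wedge_poly_monic by fastforce

lemma tn_rows_0: "tn_rows 0 M"
  unfolding tn_rows_def
proof (intro allI impI)
  fix r and f g :: "nat \<Rightarrow> nat"
  assume "f ` {..<r} \<subseteq> {..<0}"
  then have "r = 0" by auto
  then show "0 \<le> minor M r f g" by (simp add: minor_def)
qed

text \<open>A quadratic factor uses up two of the N rows, so it is only ever needed on k \<le> N - 2 rows, and then
  (k + 1) \<theta> \<le> \<pi> is the angle condition.\<close>

lemma tn_rows_toeplitz:
  "wedge_poly N g \<Longrightarrow> tn_rows (N - degree g) (toeplitz_entry g)"
proof (induction rule: wedge_poly.induct)
  case one
  show ?case by (simp add: toeplitz_entry_1 identity_tn_rows)
next
  case (linear g a)
  note g0 = wedge_poly_nonzero[OF linear(1)]
  note deg = degree_linear_times(1)[OF g0, of a]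
  show ?case
  proof (cases "degree g + 1 \<le> N")
    case True
    then have "N - (degree g + 1) + 1 = N - degree g" by linarith
    then have tn: "tn_rows (N - (degree g + 1) + 1) (toeplitz_entry g)"
      using linear(3) by metis
    show ?thesis unfolding deg
      by (rule tn_rows_linear_factor[OF tn linear(2)]) (rule toeplitz_entry_linear_factor[OF g0])
  next
    case False
    then have "N - (degree g + 1) = 0" by linarith
    then show ?thesis unfolding deg by (metis tn_rows_0)
  qed
next
  case (quadratic g \<rho> \<theta>)
  note g0 = wedge_poly_nonzero[OF quadratic(1)]
  note deg = degree_linear_times(2)[OF g0, of "\<rho>\<^sup>2" "2 * \<rho> * cos \<theta>"]
  show ?case
  proof (cases "degree g + 2 \<le> N")
    case True
    then have "real (N - (degree g + 2)) + 1 \<le> real N - 1" by (simp add: of_nat_diff)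
    then have "(real (N - (degree g + 2)) + 1) * \<theta> \<le> (real N - 1) * \<theta>"
      using quadratic(3) by (intro mult_right_mono) simp_all
    then have small: "(real (N - (degree g + 2)) + 1) * \<theta> \<le> pi"
      using quadratic(4) by linarith
    have "N - (degree g + 2) + 2 = N - degree g" using True by linarith
    then have tn: "tn_rows (N - (degree g + 2) + 2) (toeplitz_entry g)"
      using quadratic(5) by metis
    show ?thesis unfolding deg
      by (rule tn_rows_quadratic_factor[OF tn quadratic(3) small quadratic(2)])
        (rule toeplitz_entry_quadratic_factor[OF g0])
  next
    case False
    then have "N - (degree g + 2) = 0" by linarith
    then show ?thesis unfolding deg by (metis tn_rows_0)
  qed
qed


interpretation complex_poly_hom: map_poly_inj_idom_hom complex_of_real ..

lemmas poly_complex_poly_simps =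
  complex_poly_hom.hom_mult complex_poly_hom.hom_add complex_poly_hom.hom_minus
  of_real_hom.map_poly_hom_smult of_real_hom.map_poly_pCons_hom

lemma poly_complex_poly_pcompose:
  "poly (complex_poly (pcompose p q)) z = poly (complex_poly p) (poly (complex_poly q) z)"
  by (simp add: of_real_hom.map_poly_pcompose poly_pcompose)

lemma poly_complex_poly_cnj: "poly (complex_poly p) (cnj z) = cnj (poly (complex_poly p) z)"
  by (induction p) (simp_all add: of_real_hom.map_poly_pCons_hom)

section \<open>The reduction step of the Routh algorithm\<close>

text \<open>The terms of p whose exponents have the parity opposite to n. For n = degree p this is the
  polynomial that the Routh algorithm multiplies by the variable and subtracts to lower the
  degree.\<close>

definition off_part :: "nat \<Rightarrow> real poly \<Rightarrow> real poly" where
  "off_part n p = Polynomial.smult (1 / 2) (p - Polynomial.smult ((-1) ^ n) (pcompose p [:0, -1:]))"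

lemma coeff_off_part:
  "Polynomial.coeff (off_part n p) k = (if even (n + k) then 0 else Polynomial.coeff p k)"
proof -
  have "Polynomial.coeff (off_part n p) k =
      (Polynomial.coeff p k - (-1) ^ (n + k) * Polynomial.coeff p k) / 2"
    by (simp add: off_part_def coeff_pcompose_linear power_add)
  then show ?thesis by (auto simp: uminus_power_if)
qed

lemma int_coeff_off_part:
  "int_coeff (off_part n p) k = (if even (int n + k) then 0 else int_coeff p k)"
  by (auto simp: int_coeff_def coeff_off_part even_nat_iff)

text \<open>Every second row of the Hurwitz matrix contains the coefficients that the reduction leaves alone,
  so it is a shifted row of the reduced matrix; each other row differs from one by c times its
  neighbour.\<close>

lemma hurwitz_entry_routh_step:
  assumes P: "P = P' + Polynomial.smult c (pCons 0 (off_part (degree P) P))"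
    and deg: "degree P = Suc (degree P')"
  shows "hurwitz_entry P i j =
    (if odd i then c else 0) * hurwitz_entry P' i j + hurwitz_entry P' (i + 1) j"
proof -
  let ?n = "int (degree P)"
  have split: "int_coeff P k = int_coeff P' k +
      c * (if even (?n + (k - 1)) then 0 else int_coeff P (k - 1))" for k
    using arg_cong[OF P, of "\<lambda>q. int_coeff q k"] by (simp add: int_coeff_off_part)
  have "int_coeff P k = int_coeff P' k + (if even (?n + k) then c * int_coeff P' (k - 1) else 0)"
    for k
    using split[of k] split[of "k - 1"] by (auto split: if_splits)
  then have "hurwitz_entry P i j = int_coeff P' (?n + int i - 1 - 2 * int j) +
      (if even (?n + (?n + int i - 1 - 2 * int j))
       then c * int_coeff P' (?n + int i - 1 - 2 * int j - 1) else 0)"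
    unfolding hurwitz_entry_def by blast
  then show ?thesis unfolding hurwitz_entry_def deg by (auto simp: algebra_simps)
qed

section \<open>The Routh step preserves stability\<close>

text \<open>Let X and Y be the two products and t the real part of r. Adjoining the factor for r turns X - Y
  into 2 t X + (z - cnj r) (X - Y), and K into 4 t (cmod X)^2 + (cmod (z - cnj r))^2 K. The
  Cauchy-Schwarz inequality, with weights t and the sum of the earlier real parts, compares the
  two. The common quantity K avoids dividing by that
  sum, which may vanish.\<close>

lemma telescoped_modulus_bound:
  fixes rs :: "complex list"
  assumes "\<And>r. r \<in> set rs \<Longrightarrow> 0 \<le> Re r"
  shows "\<exists>K \<ge> 0.
    (cmod (\<Prod>r\<leftarrow>rs. z + r))\<^sup>2 - (cmod (\<Prod>r\<leftarrow>rs. z - cnj r))\<^sup>2 = Re z * K \<and>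
    (cmod ((\<Prod>r\<leftarrow>rs. z + r) - (\<Prod>r\<leftarrow>rs. z - cnj r)))\<^sup>2 \<le> (\<Sum>r\<leftarrow>rs. Re r) * K"
  using assms
proof (induction rs)
  case Nil
  then show ?case by (intro exI[of _ 0]) simp
next
  case (Cons r rs)
  define X where "X = (\<Prod>r\<leftarrow>rs. z + r)"
  define Y where "Y = (\<Prod>r\<leftarrow>rs. z - cnj r)"
  define \<rho> where "\<rho> = (\<Sum>r\<leftarrow>rs. Re r)"
  define t where "t = Re r"
  define u where "u = z + r"
  define v where "v = z - cnj r"
  obtain K where K: "0 \<le> K" "(cmod X)\<^sup>2 - (cmod Y)\<^sup>2 = Re z * K" "(cmod (X - Y))\<^sup>2 \<le> \<rho> * K"
    using Cons unfolding X_def Y_def \<rho>_def by auto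
  have t: "0 \<le> t" and \<rho>: "0 \<le> \<rho>"
    using Cons.prems unfolding t_def \<rho>_def by (auto intro!: sum_list_nonneg)
  define K' where "K' = 4 * t * (cmod X)\<^sup>2 + (cmod v)\<^sup>2 * K"
  have uv: "(cmod u)\<^sup>2 = (cmod v)\<^sup>2 + 4 * Re z * t"
    unfolding u_def v_def t_def cmod_power2 by (simp add: power2_eq_square algebra_simps)
  have "(cmod (u * X))\<^sup>2 - (cmod (v * Y))\<^sup>2 =
      4 * Re z * t * (cmod X)\<^sup>2 + (cmod v)\<^sup>2 * ((cmod X)\<^sup>2 - (cmod Y)\<^sup>2)"
    unfolding norm_mult power_mult_distrib uv by (simp add: algebra_simps)
  then have 1: "(cmod (u * X))\<^sup>2 - (cmod (v * Y))\<^sup>2 = Re z * K'"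
    unfolding K(2) K'_def by (simp add: algebra_simps)
  define w where "w = cmod v * cmod (X - Y)"
  define \<kappa> where "\<kappa> = (cmod v)\<^sup>2 * K"
  have w: "0 \<le> w" "w\<^sup>2 \<le> \<rho> * \<kappa>" and \<kappa>: "0 \<le> \<kappa>"
    using mult_left_mono[OF K(3), of "(cmod v)\<^sup>2"] K(1)
    unfolding w_def \<kappa>_def power_mult_distrib by (auto simp: algebra_simps)
  \<comment> \<open>Bounds the mixed term of the square below: for \<rho> > 0 by completing the square with
    the weight \<rho>, and for \<rho> = 0 because then w vanishes.\<close>
  have cross: "4 * cmod X * w \<le> \<kappa> + 4 * \<rho> * (cmod X)\<^sup>2"
  proof (cases "\<rho> = 0")
    case True
    then have "w = 0" using w by simp
    then show ?thesis using \<kappa> True by simp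
  next
    case False
    then have \<rho>0: "0 < \<rho>" using \<rho> by simp
    have "0 \<le> (2 * \<rho> * cmod X - w)\<^sup>2" by simp
    then have "\<rho> * (4 * cmod X * w) \<le> 4 * \<rho>\<^sup>2 * (cmod X)\<^sup>2 + w\<^sup>2"
      by (simp add: power2_eq_square algebra_simps)
    also have "\<dots> \<le> \<rho> * (\<kappa> + 4 * \<rho> * (cmod X)\<^sup>2)"
      using w by (simp add: power2_eq_square algebra_simps)
    finally show ?thesis using \<rho>0 by simp
  qed
  have "cmod (u * X - v * Y) \<le> 2 * t * cmod X + w"
  proof -
    have "u - v = of_real (2 * t)" unfolding u_def v_def t_def by (simp add: complex_eq_iff)
    moreover have "u * X - v * Y = (u - v) * X + v * (X - Y)" by (simp add: algebra_simps)
    ultimately have "u * X - v * Y = of_real (2 * t) * X + v * (X - Y)" by simp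
    then have "cmod (u * X - v * Y) \<le> cmod (of_real (2 * t) * X) + cmod (v * (X - Y))"
      using norm_triangle_ineq by metis
    then show ?thesis using t by (simp add: norm_mult w_def)
  qed
  then have "(cmod (u * X - v * Y))\<^sup>2 \<le> (2 * t * cmod X + w)\<^sup>2"
    by (intro power_mono) auto
  also have "\<dots> = 4 * t\<^sup>2 * (cmod X)\<^sup>2 + t * (4 * cmod X * w) + w\<^sup>2"
    by (simp add: power2_eq_square algebra_simps)
  also have "\<dots> \<le> 4 * t\<^sup>2 * (cmod X)\<^sup>2 + t * (\<kappa> + 4 * \<rho> * (cmod X)\<^sup>2) + \<rho> * \<kappa>"
    using mult_left_mono[OF cross t] w(2) by linarith
  also have "\<dots> = (t + \<rho>) * K'"
    unfolding K'_def \<kappa>_def by (simp add: power2_eq_square algebra_simps)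
  finally have 2: "(cmod (u * X - v * Y))\<^sup>2 \<le> (t + \<rho>) * K'" .
  have "0 \<le> K'" using K t unfolding K'_def by simp
  then show ?case using 1 2
    by (intro exI[of _ K']) (simp add: X_def Y_def u_def v_def t_def \<rho>_def)
qed

lemma prod_linear_factors_coeffs:
  fixes rs :: "complex list"
  defines "P \<equiv> (\<Prod>r\<leftarrow>rs. [:r, 1:])"
  shows "degree P = length rs" "Polynomial.coeff P (length rs) = 1"
    "rs \<noteq> [] \<Longrightarrow> Polynomial.coeff P (length rs - 1) = sum_list rs"
  unfolding P_def
proof (induction rs)
  case (Cons r rs)
  { case 1
    have "(\<Prod>r\<leftarrow>rs. [:r, 1:]) \<noteq> (0 :: complex poly)" using Cons(2) by auto
    then show ?case using Cons(1) by (simp add: degree_mult_eq del: mult_pCons_left) }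
  { case 2
    show ?case using Cons(1,2) by (simp add: coeff_eq_0) }
  { case 3
    show ?case using Cons(2,3) by (cases rs) (auto simp: coeff_pCons split: nat.splits) }
qed auto

definition hurwitz_stable :: "real poly \<Rightarrow> bool" where
  "hurwitz_stable q \<longleftrightarrow> 0 < lead_coeff q \<and> (\<forall>z. poly (complex_poly q) z = 0 \<longrightarrow> Re z < 0)"

text \<open>The sum of the real parts of the negated zeros is the second coefficient divided by the leading
  one, and q(-z) is, up to sign, the product with the conjugated zeros because q is real. With E and D
  the halves of the sum and difference of q(z) and its reflection, and c the leading coefficient
  divided by the second one, part two says that Re (E cnj D) is at least c Re z times the squared
  modulus of D.\<close>

lemma hurwitz_stable_modulus_bound:
  assumes q: "hurwitz_stable q" and deg: "degree q = Suc m"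
  shows "0 < Polynomial.coeff q m"
    and "0 \<le> Re z \<Longrightarrow>
      lead_coeff q * Re z * (cmod (poly (complex_poly q) z - (-1) ^ Suc m * poly (complex_poly q) (- z)))\<^sup>2
        \<le> Polynomial.coeff q m *
          ((cmod (poly (complex_poly q) z))\<^sup>2 - (cmod (poly (complex_poly q) (- z)))\<^sup>2)"
proof -
  let ?Q = "poly (complex_poly q)"
  define a where "a = lead_coeff q"
  have a: "0 < a" using q unfolding hurwitz_stable_def a_def by simp
  obtain as where as: "Polynomial.smult (lead_coeff (complex_poly q)) (\<Prod>a\<leftarrow>as. [:- a, 1:]) = complex_poly q"
    "length as = degree (complex_poly q)"
    using fundamental_theorem_algebra_factorized by blast
  define rs where "rs = map uminus as"
  define P where "P = (\<Prod>r\<leftarrow>rs. [:r, 1:])"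
  have Q: "complex_poly q = Polynomial.smult (of_real a) P" and len: "length rs = Suc m"
    using as deg unfolding P_def rs_def a_def by (simp_all add: o_def)
  have P_eval: "poly P z = (\<Prod>r\<leftarrow>rs. z + r)" for z
    unfolding P_def by (induction rs) (simp_all add: algebra_simps)
  have pos: "0 < Re r" if "r \<in> set rs" for r
  proof -
    have "poly P (- r) = 0" unfolding P_eval using that by (auto simp: prod_list_zero_iff)
    then have "?Q (- r) = 0" by (simp add: Q)
    then show ?thesis using q unfolding hurwitz_stable_def by fastforce
  qed
  define \<rho> where "\<rho> = (\<Sum>r\<leftarrow>rs. Re r)"
  obtain r rs' where rs': "rs = r # rs'" using len by (cases rs) auto
  have "0 \<le> (\<Sum>r\<leftarrow>rs'. Re r)"
    by (rule sum_list_nonneg) (use pos rs' in \<open>auto intro: less_imp_le\<close>)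
  then have "0 < \<rho>" unfolding \<rho>_def using pos[of r] rs' by simp
  have "complex_of_real (Polynomial.coeff q m) = of_real a * sum_list rs"
  proof -
    have "complex_of_real (Polynomial.coeff q m) = Polynomial.coeff (complex_poly q) m" by simp
    also have "\<dots> = of_real a * Polynomial.coeff P m" by (simp only: Q coeff_smult)
    also have "Polynomial.coeff P m = sum_list rs"
      using prod_linear_factors_coeffs(3)[of rs] len unfolding P_def by (cases rs) auto
    finally show ?thesis .
  qed
  then have "Polynomial.coeff q m = Re (of_real a * sum_list rs)" by (metis Re_complex_of_real)
  also have "Re (of_real a * sum_list rs) = a * \<rho>"
    unfolding \<rho>_def by (induction rs) (simp_all add: algebra_simps)
  finally have b: "Polynomial.coeff q m = a * \<rho>" .
  then show "0 < Polynomial.coeff q m" using a \<open>0 < \<rho>\<close> by simp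
  assume z: "0 \<le> Re z"
  define X where "X = (\<Prod>r\<leftarrow>rs. z + r)"
  define Y where "Y = (\<Prod>r\<leftarrow>rs. z - cnj r)"
  have X: "?Q z = of_real a * X" unfolding Q X_def by (simp add: P_eval)
  have "cnj (of_real a * Y) = (-1) ^ Suc m * ?Q (- cnj z)"
  proof -
    have "cnj Y = (-1) ^ length rs * (\<Prod>r\<leftarrow>rs. - cnj z + r)"
      unfolding Y_def by (induction rs) (simp_all add: algebra_simps)
    then show ?thesis unfolding Q len by (simp add: P_eval)
  qed
  also have "\<dots> = cnj ((-1) ^ Suc m * ?Q (- z))"
    using poly_complex_poly_cnj[of q "- z"] by simp
  finally have Y: "(-1) ^ Suc m * ?Q (- z) = of_real a * Y" by (metis complex_cnj_cnj)
  have Y_norm: "cmod (?Q (- z)) = cmod (of_real a * Y)"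
    using arg_cong[OF Y, of cmod] by (simp add: norm_mult norm_power)
  obtain K where K: "0 \<le> K" "(cmod X)\<^sup>2 - (cmod Y)\<^sup>2 = Re z * K" "(cmod (X - Y))\<^sup>2 \<le> \<rho> * K"
    using telescoped_modulus_bound[of rs z] pos less_imp_le unfolding X_def Y_def \<rho>_def by blast
  have "a * Re z * (cmod (of_real a * X - of_real a * Y))\<^sup>2 = a ^ 3 * (Re z * (cmod (X - Y))\<^sup>2)"
    by (simp flip: right_diff_distrib add: norm_mult power_mult_distrib power2_eq_square power3_eq_cube)
  also have "\<dots> \<le> a ^ 3 * (Re z * (\<rho> * K))"
    using a z K by (intro mult_left_mono) auto
  also have "\<dots> = a * \<rho> * (a\<^sup>2 * ((cmod X)\<^sup>2 - (cmod Y)\<^sup>2))"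
    unfolding K(2) by (simp add: power2_eq_square power3_eq_cube)
  also have "a\<^sup>2 * ((cmod X)\<^sup>2 - (cmod Y)\<^sup>2) = (cmod (?Q z))\<^sup>2 - (cmod (?Q (- z)))\<^sup>2"
    unfolding X Y_norm by (simp add: norm_mult power_mult_distrib algebra_simps)
  finally show "lead_coeff q * Re z * (cmod (?Q z - (-1) ^ Suc m * ?Q (- z)))\<^sup>2
      \<le> Polynomial.coeff q m * ((cmod (?Q z))\<^sup>2 - (cmod (?Q (- z)))\<^sup>2)"
    unfolding Y b X a_def[symmetric] .
qed

text \<open>The reduced polynomial takes the value E + D - c z D. Where it vanishes in the closed right
  half-plane, E = c z D - D, so Re (E cnj D) = (c Re z - 1) (cmod D)^2. By the modulus bound D = 0,
  and then q itself vanishes.\<close>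

lemma hurwitz_stable_routh_step:
  assumes q: "hurwitz_stable q" and deg: "degree q = Suc m"
  obtains c q' where "0 < c" "hurwitz_stable q'" "degree q' = m"
    "q = q' + Polynomial.smult c (pCons 0 (off_part (Suc m) q))"
proof -
  let ?Q = "poly (complex_poly q)"
  define a where "a = lead_coeff q"
  define b where "b = Polynomial.coeff q m"
  define c where "c = a / b"
  define q' where "q' = q - Polynomial.smult c (pCons 0 (off_part (Suc m) q))"
  have a: "0 < a" and b: "0 < b"
    using q hurwitz_stable_modulus_bound(1)[OF q deg] unfolding hurwitz_stable_def a_def b_def by auto
  then have c: "0 < c" unfolding c_def by simp
  have coeff: "Polynomial.coeff q' (Suc k) = Polynomial.coeff q (Suc k) -
      (if even (Suc m + k) then 0 else c * Polynomial.coeff q k)" for k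
    unfolding q'_def by (simp add: coeff_off_part)
  have top: "Polynomial.coeff q' (Suc k) = 0" if "m \<le> k" for k
  proof (cases "k = m")
    case True
    then show ?thesis unfolding coeff using b a_def deg b_def by (simp add: c_def)
  next
    case False
    then show ?thesis unfolding coeff using that deg by (cases "k = Suc m") (auto simp: coeff_eq_0)
  qed
  have lead: "Polynomial.coeff q' m = b"
  proof (cases m)
    case 0
    then show ?thesis unfolding q'_def b_def by simp
  next
    case (Suc k)
    then show ?thesis unfolding b_def by (simp add: coeff)
  qed
  have deg': "degree q' = m"
  proof (rule antisym)
    show "degree q' \<le> m" using top by (intro degree_le) (metis Suc_le_D Suc_le_eq Suc_le_mono)
    show "m \<le> degree q'" using lead b by (intro le_degree) simp
  qed
  have nonzero: False if zero: "poly (complex_poly q') z = 0" and z: "0 \<le> Re z" for z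
  proof -
    define X where "X = ?Q z"
    define Y where "Y = (-1) ^ Suc m * ?Q (- z)"
    have Yn: "cmod (?Q (- z)) = cmod Y" unfolding Y_def by (simp add: norm_mult norm_power)
    define E where "E = (X + Y) / 2"
    define D where "D = (X - Y) / 2"
    have q'z: "poly (complex_poly q') z = X - of_real c * z * D"
      unfolding q'_def off_part_def D_def X_def Y_def
      by (simp add: poly_complex_poly_simps poly_complex_poly_pcompose of_real_hom.map_poly_pCons_hom)
    have "a * Re z * (cmod (X - Y))\<^sup>2 \<le> b * ((cmod X)\<^sup>2 - (cmod Y)\<^sup>2)"
      using hurwitz_stable_modulus_bound(2)[OF q deg z] unfolding a_def b_def X_def[symmetric] Y_def[symmetric] Yn .
    moreover have "(cmod (X - Y))\<^sup>2 = 4 * (cmod D)\<^sup>2"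
      unfolding D_def by (simp add: norm_divide power_divide)
    moreover have "(cmod X)\<^sup>2 - (cmod Y)\<^sup>2 = 4 * Re (E * cnj D)"
      unfolding E_def D_def cmod_power2 by (simp add: power2_eq_square field_simps)
    ultimately have "a * Re z * (cmod D)\<^sup>2 \<le> b * Re (E * cnj D)" by (simp add: algebra_simps)
    then have le: "c * Re z * (cmod D)\<^sup>2 \<le> Re (E * cnj D)"
      unfolding c_def using b by (simp add: field_simps)
    have "X = E + D" unfolding E_def D_def by (simp add: field_simps)
    then have E: "E = of_real c * z * D - D" using q'z zero by (simp add: algebra_simps)
    have "E * cnj D = (of_real c * z - 1) * of_real ((cmod D)\<^sup>2)"
      unfolding E complex_norm_square by (simp add: algebra_simps)
    then have "Re (E * cnj D) = (c * Re z - 1) * (cmod D)\<^sup>2" by simp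
    also have "\<dots> = c * Re z * (cmod D)\<^sup>2 - (cmod D)\<^sup>2" by (simp add: algebra_simps)
    finally have "(cmod D)\<^sup>2 \<le> 0" using le by linarith
    then have "D = 0" by simp
    then have "?Q z = 0" using q'z zero unfolding X_def by simp
    then show False using q z unfolding hurwitz_stable_def by force
  qed
  show ?thesis
  proof (rule that[OF c _ deg'])
    show "hurwitz_stable q'"
      unfolding hurwitz_stable_def deg' lead using b nonzero by force
    show "q = q' + Polynomial.smult c (pCons 0 (off_part (Suc m) q))"
      unfolding q'_def by simp
  qed
qed


section \<open>Hurwitz matrices of products of an even and a stable polynomial\<close>

abbreviation square_subst :: "real poly \<Rightarrow> real poly" where
  "square_subst g \<equiv> pcompose g [:0, 0, 1:]"

lemma coeff_square_subst:
  "Polynomial.coeff (square_subst g) k = (if even k then Polynomial.coeff g (k div 2) else 0)"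
proof (induction g arbitrary: k)
  case (pCons a g)
  have "square_subst (pCons a g) = [:a:] + pCons 0 (pCons 0 (square_subst g))"
    by (simp add: pcompose_pCons)
  then show ?case by (auto simp: coeff_pCons pCons.IH split: nat.splits)
qed simp

lemma int_coeff_square_subst:
  "int_coeff (square_subst g) k = (if even k then int_coeff g (k div 2) else 0)"
  by (auto simp: int_coeff_def coeff_square_subst even_nat_iff nat_div_distrib)

lemma degree_square_subst: "degree (square_subst g) = 2 * degree g"
  by (simp add: degree_pcompose)

lemma square_subst_eq_0_iff [simp]: "square_subst g = 0 \<longleftrightarrow> g = 0"
  by (simp add: pcompose_eq_0_iff)

lemma degree_square_subst_times:
  "g \<noteq> 0 \<Longrightarrow> q \<noteq> 0 \<Longrightarrow> degree (square_subst g * q) = 2 * degree g + degree q"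
  by (simp add: degree_mult_eq degree_square_subst)

lemma lead_coeff_square_subst: "lead_coeff (square_subst g) = lead_coeff g"
  by (simp add: degree_square_subst coeff_square_subst)

lemma off_part_even_factor:
  "off_part (2 * d + n) (square_subst g * q) = square_subst g * off_part n q"
proof -
  have "pcompose (square_subst g) [:0, -1:] = square_subst g"
    by (simp flip: pcompose_assoc add: pcompose_pCons)
  then show ?thesis by (simp add: off_part_def pcompose_mult power_add algebra_simps)
qed

lemma hurwitz_entry_even:
  assumes "c \<noteq> 0" "g \<noteq> 0"
  shows "hurwitz_entry (square_subst g * [:c:]) i j =
    (if odd i then c else 0) * toeplitz_entry g (i div 2) j"
proof -
  have "square_subst g * [:c:] = Polynomial.smult c (square_subst g)" by simp
  then have "hurwitz_entry (square_subst g * [:c:]) i j =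
      c * int_coeff (square_subst g) (2 * int (degree g) + int i - 1 - 2 * int j)"
    using assms by (simp add: hurwitz_entry_def degree_square_subst del: mult_pCons_right)
  also have "int_coeff (square_subst g) (2 * int (degree g) + int i - 1 - 2 * int j) =
      (if odd i then toeplitz_entry g (i div 2) j else 0)"
  proof (cases "odd i")
    case True
    then obtain s where "i = 2 * s + 1" by (rule oddE)
    then show ?thesis by (simp add: int_coeff_square_subst toeplitz_entry_def)
  qed (simp add: int_coeff_square_subst)
  finally show ?thesis by simp
qed

lemma hurwitz_entry_routh_step_even_factor:
  assumes q: "q = q' + Polynomial.smult c (pCons 0 (off_part (degree q) q))"
    and deg: "degree q = Suc (degree q')" and nz: "q' \<noteq> 0" "g \<noteq> 0"
  shows "hurwitz_entry (square_subst g * q) i j = (if odd i then c else 0) *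
    hurwitz_entry (square_subst g * q') i j + hurwitz_entry (square_subst g * q') (i + 1) j"
proof (rule hurwitz_entry_routh_step)
  have "q \<noteq> 0" using deg by auto
  then have degs: "degree (square_subst g * q) = 2 * degree g + degree q"
    "degree (square_subst g * q') = 2 * degree g + degree q'"
    using nz by (simp_all add: degree_square_subst_times)
  then show "degree (square_subst g * q) = Suc (degree (square_subst g * q'))" using deg by simp
  have "square_subst g * q = square_subst g * q' +
      Polynomial.smult c (pCons 0 (square_subst g * off_part (degree q) q))"
    by (subst q) (simp add: distrib_left)
  then show "square_subst g * q = square_subst g * q' +
      Polynomial.smult c (pCons 0 (off_part (degree (square_subst g * q)) (square_subst g * q)))"
    unfolding degs off_part_even_factor .
qed

text \<open>For constant q the Hurwitz matrix is the Toeplitz matrix of g with a zero row inserted before each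
  row, which doubles the number of rows. Each Routh step backwards costs one row.\<close>

lemma tn_rows_hurwitz:
  assumes "tn_rows R (toeplitz_entry g)" "g \<noteq> 0" "hurwitz_stable q" "degree q = m"
  shows "tn_rows (2 * R - m) (hurwitz_entry (square_subst g * q))"
  using assms(3,4)
proof (induction m arbitrary: q)
  case 0
  then obtain c where q: "q = [:c:]" by (auto elim: degree_eq_zeroE)
  then have c: "0 < c" using 0 by (simp add: hurwitz_stable_def)
  show ?case unfolding q
    by (rule tn_rows_row_combination[OF assms(1), where u = "\<lambda>i. i div 2" and v = "\<lambda>i. i div 2"
          and s = "\<lambda>i. if odd i then c else 0" and t = "\<lambda>_. 0"])
      (use c assms(2) in \<open>auto simp: hurwitz_entry_even div_le_mono simp del: mult_pCons_right\<close>)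
next
  case (Suc m)
  obtain c q' where c: "0 < c" and q': "hurwitz_stable q'" "degree q' = m"
    "q = q' + Polynomial.smult c (pCons 0 (off_part (Suc m) q))"
    using hurwitz_stable_routh_step[OF Suc.prems] by blast
  have "q' \<noteq> 0" using q'(1) by (auto simp: hurwitz_stable_def)
  then have entry: "hurwitz_entry (square_subst g * q) i j = (if odd i then c else 0) *
    hurwitz_entry (square_subst g * q') i j + 1 * hurwitz_entry (square_subst g * q') (i + 1) j" for i j
    using hurwitz_entry_routh_step_even_factor[of q q' c g i j] q' Suc.prems(2) assms(2) by simp
  show ?case
    by (rule tn_rows_row_combination[OF Suc.IH[OF q'(1,2)], where u = "\<lambda>i. i" and v = "\<lambda>i. i + 1"
          and s = "\<lambda>i. if odd i then c else 0" and t = "\<lambda>_. 1"]) (use c entry in auto)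
qed

lemma tn_rows_hurwitz_stable: "hurwitz_stable q \<Longrightarrow> tn_rows R (hurwitz_entry q)"
  using tn_rows_hurwitz[of "R + degree q" 1 q] identity_tn_rows
  by (auto simp: toeplitz_entry_1 pcompose_1 intro: tn_rows_mono)

text \<open>Reducing q to a constant turns the Hurwitz matrix into one with a single entry in every odd row,
  namely in row 2 a + 1 and column a. Among the terms of the expansion, one moves the selected row
  f a down by one in each step until it reaches 2 a + 1 and then keeps it; m steps suffice, and the
  coefficient for keeping an odd row is the positive Routh constant.\<close>

lemma hurwitz_minor_pos:
  assumes "hurwitz_stable q" "degree q = m" "strict_mono_on {..<r} f"
    and "\<And>a. a < r \<Longrightarrow> f a \<le> 2 * a + 1 \<and> 2 * a + 1 \<le> f a + m"
  shows "0 < minor (hurwitz_entry q) r f (\<lambda>b. b)"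
  using assms
proof (induction m arbitrary: q f)
  case 0
  then obtain c where q: "q = [:c:]" by (auto elim: degree_eq_zeroE)
  then have c: "0 < c" using 0 by (simp add: hurwitz_stable_def)
  have f: "f a = 2 * a + 1" if "a < r" for a using 0(4)[OF that] by simp
  have "mat r r (\<lambda>(a, b). hurwitz_entry q (f a) b) = c \<cdot>\<^sub>m 1\<^sub>m r"
    using hurwitz_entry_even[of c 1] c f
    by (intro eq_matI) (auto simp: q pcompose_1 toeplitz_entry_1)
  then show ?case using c by (simp add: minor_def)
next
  case (Suc m)
  obtain c q' where c: "0 < c" and q': "hurwitz_stable q'" "degree q' = m"
    "q = q' + Polynomial.smult c (pCons 0 (off_part (Suc m) q))"
    using hurwitz_stable_routh_step[OF Suc.prems(1,2)] by blast
  have "q' \<noteq> 0" using q'(1) by (auto simp: hurwitz_stable_def)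
  then have entry: "hurwitz_entry q i j =
      (if odd i then c else 0) * hurwitz_entry q' i j + 1 * hurwitz_entry q' (i + 1) j" for i j
    using hurwitz_entry_routh_step[of q q' c i j] q' Suc.prems(2) by simp
  define arrived where "arrived a = (f a = 2 * a + 1)" for a
  define f' where "f' a = (if arrived a then f a else f a + 1)" for a
  have "0 < minor (hurwitz_entry q') r f' (\<lambda>b. b)"
  proof (rule Suc.IH[OF q'(1,2)])
    show "strict_mono_on {..<r} f'"
    proof (rule strict_mono_onI)
      fix a b assume ab: "a \<in> {..<r}" "b \<in> {..<r}" "a < b"
      then have "f a < f b" using Suc.prems(3) by (auto simp: strict_mono_on_def)
      then show "f' a < f' b" using Suc.prems(4)[of a] ab unfolding f'_def arrived_def by auto
    qed
    show "f' a \<le> 2 * a + 1 \<and> 2 * a + 1 \<le> f' a + m" if "a < r" for a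
      using Suc.prems(4)[OF that] unfolding f'_def arrived_def by auto
  qed
  moreover have "0 < (\<Prod>a<r. if arrived a then if odd (f a) then c else 0 else 1)"
    using c by (intro prod_pos) (auto simp: arrived_def)
  moreover have "(\<Prod>a<r. if arrived a then if odd (f a) then c else 0 else 1) *
      minor (hurwitz_entry q') r (\<lambda>a. if arrived a then f a else f a + 1) (\<lambda>b. b)
        \<le> minor (hurwitz_entry q) r f (\<lambda>b. b)"
  proof (rule minor_row_combination_lower_bound[where R' = "2 * r"])
    show "tn_rows (2 * r + 1) (hurwitz_entry q')" by (rule tn_rows_hurwitz_stable[OF q'(1)])
    show "f ` {..<r} \<subseteq> {..<2 * r}" using Suc.prems(4) by fastforce
  qed (use Suc.prems(3) c entry in \<open>auto simp: strict_mono_on_def\<close>)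
  ultimately show ?case unfolding f'_def
    by (smt (verit, best) mult_pos_pos)
qed


section \<open>The even factor carrying the zeros in the closed right half-plane\<close>

lemma prod_linear_factors_dvd:
  fixes P :: "complex poly"
  assumes "distinct as" "\<And>a. a \<in> set as \<Longrightarrow> poly P a = 0"
  shows "(\<Prod>a\<leftarrow>as. [:- a, 1:]) dvd P"
  using assms
proof (induction as arbitrary: P)
  case (Cons a as)
  then have "[:- a, 1:] dvd P" by (simp add: poly_eq_0_iff_dvd)
  then obtain R where R: "P = [:- a, 1:] * R" by (rule dvdE)
  have "poly R b = 0" if "b \<in> set as" for b
  proof -
    have "b \<noteq> a" using that Cons.prems(1) by auto
    moreover have "poly P b = 0" using that Cons.prems(2) by simp
    ultimately show ?thesis by (simp add: R)
  qed
  then have "(\<Prod>a\<leftarrow>as. [:- a, 1:]) dvd R" using Cons by auto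
  then show ?case unfolding R by (simp only: list.simps prod_list.Cons mult_dvd_mono dvd_refl)
qed simp

text \<open>Substituting -x for x turns the factor (x - z)^k into a factor (x + z)^k up to sign.\<close>

lemma order_even_poly:
  fixes P :: "complex poly"
  assumes "P \<noteq> 0" "pcompose P [:0, -1:] = P"
  shows "Polynomial.order (- z) P = Polynomial.order z P"
proof -
  have le: "Polynomial.order z P \<le> Polynomial.order (- z) P" for z
  proof -
    define k where "k = Polynomial.order z P"
    have pow: "pcompose ([:- z, 1:] ^ k) [:0, -1:] = [:- z, -1:] ^ k"
      by (induction k) (simp_all add: pcompose_mult pcompose_1 pcompose_pCons del: mult_pCons_left)
    obtain R where "P = [:- z, 1:] ^ k * R" using order_1[of z P] unfolding k_def by (auto elim: dvdE)
    then have "P = [:- z, -1:] ^ k * pcompose R [:0, -1:]"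
      using assms(2) pow by (metis pcompose_mult)
    then have "[:- z, -1:] ^ k dvd P" by (metis dvd_triv_left)
    moreover have "[:- z, -1:] = - [:z, 1:]" by simp
    then have "[:z, 1:] ^ k dvd [:- z, -1:] ^ k" by (metis dvd_minus_iff dvd_refl dvd_power_same)
    ultimately have "[:- (- z), 1:] ^ k dvd P" by (metis dvd_trans minus_minus)
    then show ?thesis using assms(1) order_divides k_def by metis
  qed
  show ?thesis using le[of z] le[of "- z"] by simp
qed

lemma order_complex_square_subst:
  assumes "h \<noteq> 0"
  shows "Polynomial.order (- z) (complex_poly (square_subst h)) =
    Polynomial.order z (complex_poly (square_subst h))"
proof (rule order_even_poly)
  show "complex_poly (square_subst h) \<noteq> 0" using assms by simp
  have "pcompose (square_subst h) [:0, -1:] = square_subst h"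
    by (simp flip: pcompose_assoc add: pcompose_pCons)
  then have "complex_poly (pcompose (square_subst h) [:0, -1:]) = complex_poly (square_subst h)"
    by simp
  then show "pcompose (complex_poly (square_subst h)) [:0, -1:] = complex_poly (square_subst h)"
    by (simp only: of_real_hom.map_poly_pcompose) (simp add: of_real_hom.map_poly_pCons_hom)
qed

lemma reflection_property_even_factor_iff:
  assumes "square_subst h * p \<noteq> 0"
  shows "reflection_property (square_subst h * p) \<longleftrightarrow> reflection_property p"
proof -
  have "complex_poly (square_subst h) * complex_poly p \<noteq> 0"
    using assms complex_poly_hom.hom_0_iff by (simp flip: complex_poly_hom.hom_mult)
  moreover have "h \<noteq> 0" using assms by auto
  ultimately show ?thesis
    by (simp add: reflection_property_def complex_poly_hom.hom_mult order_mult
        order_complex_square_subst)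
qed

lemma Re_square_eq_cos_double_Arg: "Re (z\<^sup>2) = (cmod z)\<^sup>2 * cos (2 * \<bar>Arg z\<bar>)"
proof -
  have "Re (rcis (cmod z) (Arg z) ^ 2) = (cmod z)\<^sup>2 * cos (2 * Arg z)"
    by (simp add: DeMoivre2)
  then show ?thesis by (simp add: rcis_cmod_Arg abs_if)
qed

lemma abs_Arg_less_half_pi:
  assumes "0 < Re z"
  shows "\<bar>Arg z\<bar> < pi / 2"
proof (rule ccontr)
  assume "\<not> \<bar>Arg z\<bar> < pi / 2"
  then have "cos \<bar>Arg z\<bar> \<le> cos (pi / 2)"
    using Arg_bounded[of z] by (intro cos_monotone_0_pi_le) auto
  then have "cos (Arg z) \<le> 0" by simp
  moreover have "z \<noteq> 0" using assms by auto
  ultimately show False using cos_Arg[of z] assms by (simp add: divide_le_0_iff)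
qed

text \<open>The squares of the four zeros are \<rho> exp(\<plusminus>2i Arg l) = -\<rho> exp(\<plusminus>i\<theta>), so the sector condition
  on l is an upper bound for \<theta>.\<close>

lemma quartic_factorization:
  fixes l :: complex
  assumes "0 < Re l"
  defines "\<rho> \<equiv> (cmod l)\<^sup>2" and "\<theta> \<equiv> pi - 2 * \<bar>Arg l\<bar>"
  shows "complex_poly (square_subst [:\<rho>\<^sup>2, 2 * \<rho> * cos \<theta>, 1:]) =
    (\<Prod>a\<leftarrow>[l, - l, cnj l, - cnj l]. [:- a, 1:])"
proof -
  have c: "2 * \<rho> * cos \<theta> = - 2 * Re (l\<^sup>2)"
    unfolding Re_square_eq_cos_double_Arg \<rho>_def \<theta>_def by (simp add: cos_diff)
  have "l\<^sup>2 + (cnj l)\<^sup>2 = of_real (2 * Re (l\<^sup>2))"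
    by (simp add: complex_eq_iff power2_eq_square)
  moreover have "complex_of_real \<rho> = l * cnj l" unfolding \<rho>_def by (rule complex_norm_square)
  then have "l\<^sup>2 * (cnj l)\<^sup>2 = of_real (\<rho>\<^sup>2)" by (simp add: power_mult_distrib)
  moreover have "(\<Prod>a\<leftarrow>[l, - l, cnj l, - cnj l]. [:- a, 1:]) =
      [:l\<^sup>2 * (cnj l)\<^sup>2, 0, - (l\<^sup>2 + (cnj l)\<^sup>2), 0, 1:]"
    by (simp add: power2_eq_square algebra_simps)
  ultimately show ?thesis unfolding c
    by (simp add: pcompose_pCons of_real_hom.map_poly_pCons_hom)
qed

text \<open>A zero on the imaginary axis is removed together with its conjugate; a zero l in the open right
  half-plane together with its conjugate and, by the reflection property, their negatives. The
  removed factors are even, so the quotient inherits the reflection property.\<close>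

lemma even_factor_splitting:
  fixes p :: "real poly"
  assumes "0 < lead_coeff p" "Polynomial.coeff p 0 \<noteq> 0" "reflection_property p"
    and "\<And>z. poly (complex_poly p) z = 0 \<Longrightarrow> 0 < Re z \<Longrightarrow>
      Im z \<noteq> 0 \<and> (real N - 1) * (pi - 2 * \<bar>Arg z\<bar>) \<le> pi"
  obtains g q where "p = square_subst g * q" "wedge_poly N g" "hurwitz_stable q"
proof -
  have "\<exists>g q. p = square_subst g * q \<and> wedge_poly N g \<and> hurwitz_stable q"
    using assms
  proof (induction "degree p" arbitrary: p rule: less_induct)
    case less
    let ?P = "complex_poly p"
    show ?case
    proof (cases "\<exists>l. poly ?P l = 0 \<and> 0 \<le> Re l")
      case False
      then have "hurwitz_stable p" using less.prems(1) unfolding hurwitz_stable_def by force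
      then show ?thesis by (intro exI[of _ 1] exI[of _ p]) (simp add: wedge_poly.one pcompose_1)
    next
      case True
      then obtain l where l: "poly ?P l = 0" "0 \<le> Re l" by blast
      have l0: "l \<noteq> 0" using l(1) less.prems(2) by (auto simp: poly_0_coeff_0)
      have lc: "poly ?P (cnj l) = 0" using l(1) by (simp add: poly_complex_poly_cnj)
      \<comment> \<open>Both kinds of zeros are removed by dividing by an even polynomial h(z^2).\<close>
      have step: ?thesis
        if dvd: "complex_poly (square_subst h) dvd ?P" and h: "lead_coeff h = 1" "0 < degree h"
          and wedge: "\<And>g. wedge_poly N g \<Longrightarrow> wedge_poly N (h * g)" for h
      proof -
        have "square_subst h dvd p" by (rule of_real_hom.dvd_map_poly_hom_imp_dvd[OF dvd])
        then obtain p' where p': "p = square_subst h * p'" by (auto elim: dvdE)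
        have nz: "square_subst h * p' \<noteq> 0" using less.prems(1) p' by auto
        have deg: "degree p = 2 * degree h + degree p'"
          using nz unfolding p' by (intro degree_square_subst_times) auto
        have lead: "lead_coeff p = lead_coeff p'"
          unfolding p' lead_coeff_mult lead_coeff_square_subst h by simp
        have root: "poly ?P z = 0" if "poly (complex_poly p') z = 0" for z
          using that by (simp add: p' complex_poly_hom.hom_mult)
        have "\<exists>g q. p' = square_subst g * q \<and> wedge_poly N g \<and> hurwitz_stable q"
        proof (rule less.hyps)
          show "degree p' < degree p" using deg h(2) by simp
          show "0 < lead_coeff p'" using less.prems(1) lead by simp
          show "Polynomial.coeff p' 0 \<noteq> 0" using less.prems(2) by (auto simp: p' coeff_mult_0)
          show "reflection_property p'"
            using less.prems(3) reflection_property_even_factor_iff[OF nz] p' by simp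
        qed (use less.prems(4) root in blast)
        then obtain g q where "p' = square_subst g * q" "wedge_poly N g" "hurwitz_stable q" by blast
        then show ?thesis using wedge[of g]
          by (intro exI[of _ "h * g"] exI[of _ q]) (simp add: p' pcompose_mult mult.assoc)
      qed
      show ?thesis
      proof (cases "Re l = 0")
        case True
        then have im: "Im l \<noteq> 0" using l0 by (auto simp: complex_eq_iff)
        have li: "l = \<i> * of_real (Im l)" "cnj l = - l" using True by (simp_all add: complex_eq_iff)
        have "complex_poly (square_subst [:(Im l)\<^sup>2, 1:]) = [:(of_real (Im l))\<^sup>2, 0, 1:]"
          by (simp add: pcompose_pCons of_real_hom.map_poly_pCons_hom)
        also have "\<dots> = (\<Prod>a\<leftarrow>[l, cnj l]. [:- a, 1:])"
          unfolding li(2) by (subst (2 3) li(1)) (simp add: power2_eq_square complex_eq_iff)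
        also have "\<dots> dvd ?P"
        proof (rule prod_linear_factors_dvd)
          show "distinct [l, cnj l]" using im by (auto simp: complex_eq_iff)
        qed (use l lc in auto)
        finally show ?thesis
          by (rule step) (auto intro: wedge_poly.linear simp del: mult_pCons_left)
      next
        case False
        then have re: "0 < Re l" using l by simp
        note l' = less.prems(4)[OF l(1) re]
        define \<rho> where "\<rho> = (cmod l)\<^sup>2"
        define \<theta> where "\<theta> = pi - 2 * \<bar>Arg l\<bar>"
        have "1 \<le> Polynomial.order z ?P" if "poly ?P z = 0" for z
          using that less.prems(1) by (auto simp: order_root Suc_le_eq)
        then have "Polynomial.order (- z) ?P \<noteq> 0" if "poly ?P z = 0" "0 < Re z" for z
          using that less.prems(3) unfolding reflection_property_def
          by (metis One_nat_def le_trans not_one_le_zero)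
        then have "poly ?P (- l) = 0" "poly ?P (- cnj l) = 0"
          using l(1) lc re by (auto simp: order_root)
        moreover have "distinct [l, - l, cnj l, - cnj l]" using re l' by (auto simp: complex_eq_iff)
        ultimately have "(\<Prod>a\<leftarrow>[l, - l, cnj l, - cnj l]. [:- a, 1:]) dvd ?P"
          using l(1) lc by (intro prod_linear_factors_dvd) auto
        then have "complex_poly (square_subst [:\<rho>\<^sup>2, 2 * \<rho> * cos \<theta>, 1:]) dvd ?P"
          unfolding \<rho>_def \<theta>_def quartic_factorization[OF re] .
        then show ?thesis
        proof (rule step)
          have "0 < \<theta>" using abs_Arg_less_half_pi[OF re] unfolding \<theta>_def by simp
          then show "wedge_poly N ([:\<rho>\<^sup>2, 2 * \<rho> * cos \<theta>, 1:] * g)" if "wedge_poly N g" for g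
            using that l' unfolding \<theta>_def[symmetric]
            by (intro wedge_poly.quadratic) (auto simp: \<rho>_def)
        qed auto
      qed
    qed
  qed
  then show thesis using that by blast
qed

text \<open>The row count is exact: with d = degree g the Toeplitz matrix is good for n - d rows, hence the
  Hurwitz matrix for 2 (n - d) - degree q = n rows.\<close>

lemma totally_nonnegative_if_reflection_property:
  assumes p: "0 < lead_coeff p" "Polynomial.coeff p 0 \<noteq> 0" "reflection_property p"
    and zeros: "\<And>z. poly (complex_poly p) z = 0 \<Longrightarrow> 0 < Re z \<Longrightarrow>
      Im z \<noteq> 0 \<and> (real (degree p) - 1) * (pi - 2 * \<bar>Arg z\<bar>) \<le> pi"
  shows "totally_nonnegative (finite_hurwitz_matrix p)"
proof -
  obtain g q where gq: "p = square_subst g * q" "wedge_poly (degree p) g" "hurwitz_stable q"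
    using even_factor_splitting[OF p zeros] by blast
  have nz: "g \<noteq> 0" "q \<noteq> 0"
    using gq wedge_poly_nonzero by (auto simp: hurwitz_stable_def)
  then have deg: "degree p = 2 * degree g + degree q"
    unfolding gq(1) by (intro degree_square_subst_times) auto
  have "tn_rows (2 * (degree p - degree g) - degree q) (hurwitz_entry p)"
    using tn_rows_hurwitz[OF tn_rows_toeplitz[OF gq(2)] nz(1) gq(3) refl] gq(1) by simp
  moreover have "2 * (degree p - degree g) - degree q = degree p" using deg by simp
  ultimately show ?thesis by (intro totally_nonnegative_if_tn_rows) metis
qed

lemma quasi_stable_imp_totally_nonnegative:
  assumes "0 < lead_coeff p" "Polynomial.coeff p 0 \<noteq> 0" "quasi_stable p"
  shows "totally_nonnegative (finite_hurwitz_matrix p)"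
proof (rule totally_nonnegative_if_reflection_property[OF assms(1,2)])
  have right: "poly (complex_poly p) z \<noteq> 0" if "0 < Re z" for z
    using assms(3) that unfolding quasi_stable_def by force
  then show "reflection_property p"
    unfolding reflection_property_def by (simp add: order_0I)
  show "Im z \<noteq> 0 \<and> (real (degree p) - 1) * (pi - 2 * \<bar>Arg z\<bar>) \<le> pi"
    if "poly (complex_poly p) z = 0" "0 < Re z" for z
    using right that by blast
qed

lemma sector_imp_totally_nonnegative:
  assumes n: "4 \<le> degree p" and p: "0 < lead_coeff p" "0 < Polynomial.coeff p 0"
    and sector: "no_zeros_in_sector p (pi / 2 * ((real (degree p) - 2) / (real (degree p) - 1)))"
    and refl: "reflection_property p"
  shows "totally_nonnegative (finite_hurwitz_matrix p)"
proof (rule totally_nonnegative_if_reflection_property)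
  define n where "n = real (degree p)"
  have n4: "4 \<le> n" using n unfolding n_def by simp
  fix z assume z: "poly (complex_poly p) z = 0" "0 < Re z"
  then have "pi / 2 * ((n - 2) / (n - 1)) \<le> \<bar>Arg z\<bar>"
    using sector unfolding no_zeros_in_sector_def n_def by (metis less_irrefl linorder_not_le zero_complex.sel(1))
  then have *: "pi * (n - 2) \<le> 2 * \<bar>Arg z\<bar> * (n - 1)"
    using n4 by (simp add: field_simps)
  then have "(n - 1) * (pi - 2 * \<bar>Arg z\<bar>) \<le> pi" by (simp add: algebra_simps)
  moreover have "0 < pi * (n - 2)" using n4 by simp
  then have "Arg z \<noteq> 0" using * by auto
  then have "Im z \<noteq> 0"
    using z(2) cis_Arg_unique[of z 0] by (auto simp: complex_eq_iff sgn_eq cmod_def)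
  ultimately show "Im z \<noteq> 0 \<and> (real (degree p) - 1) * (pi - 2 * \<bar>Arg z\<bar>) \<le> pi"
    unfolding n_def by simp
qed (use p refl in auto)

section \<open>The converse in degree at most three\<close>

lemma minor_1: "minor M (Suc 0) f g = M (f 0) (g 0)"
  unfolding minor_def by (subst det_single) auto

lemma minor_2: "minor M 2 f g = M (f 0) (g 0) * M (f 1) (g 1) - M (f 0) (g 1) * M (f 1) (g 0)"
proof -
  let ?A = "mat 2 2 (\<lambda>(a, b). M (f a) (g b))"
  have "det ?A = (\<Sum>i<2. ?A $$ (i, 0) * cofactor ?A i 0)"
    by (rule laplace_expansion_column) auto
  also have "\<dots> = ?A $$ (0, 0) * cofactor ?A 0 0 + ?A $$ (1, 0) * cofactor ?A 1 0"
    by (simp add: numeral_2_eq_2)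
  also have "cofactor ?A 0 0 = M (f 1) (g 1)"
    by (simp add: cofactor_def mat_delete_def det_single)
  also have "cofactor ?A 1 0 = - M (f 0) (g 1)"
    by (simp add: cofactor_def mat_delete_def det_single)
  finally show ?thesis unfolding minor_def by simp
qed

text \<open>In degree 3 a zero x + i y with y \<noteq> 0 satisfies two real equations. Eliminating y^2 expresses
  the Hurwitz determinant c 1 c 2 - c 0 c 3 as a sum of terms that are all nonpositive, one of them
  strictly negative, when x > 0.\<close>

lemma totally_nonnegative_imp_quasi_stable:
  assumes n: "1 \<le> degree p" "degree p \<le> 3" and lead: "0 < lead_coeff p"
    and c0: "0 < Polynomial.coeff p 0" and tn: "totally_nonnegative (finite_hurwitz_matrix p)"
  shows "quasi_stable p"
  unfolding quasi_stable_def
proof (intro allI impI, rule ccontr)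
  fix z assume z: "poly (complex_poly p) z = 0" "\<not> Re z \<le> 0"
  let ?c = "Polynomial.coeff p"
  define x where "x = Re z"
  define y where "y = Im z"
  have x: "0 < x" using z unfolding x_def by simp
  have entry: "0 \<le> hurwitz_entry p i j" if "i < degree p" "j < degree p" for i j
  proof -
    have "strict_mono_on {..<Suc 0} (\<lambda>_. k)" for k :: nat by (auto simp: strict_mono_on_def)
    then have "0 \<le> minor (hurwitz_entry p) (Suc 0) (\<lambda>_. i) (\<lambda>_. j)"
      by (intro tn[unfolded totally_nonnegative_iff_minors, rule_format]) (use that in auto)
    then show ?thesis by (simp add: minor_1)
  qed
  have z_eq: "z = Complex x y" unfolding x_def y_def by simp
  consider "degree p = 1" | "degree p = 2" | "degree p = 3" using n by linarith
  then show False
  proof cases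
    case 1
    then have "p = [:?c 0, ?c 1:]"
      by (intro poly_eqI) (auto simp: coeff_pCons coeff_eq_0 split: nat.splits)
    then have "complex_poly p = [:of_real (?c 0), of_real (?c 1):]"
      by (metis of_real_hom.map_poly_pCons_hom map_poly_0)
    then have "?c 0 + x * ?c 1 = 0" using z(1) by (simp add: z_eq complex_eq_iff)
    then show False using c0 lead 1 mult_pos_pos[OF x, of "?c 1"] by simp
  next
    case 2
    have c1: "0 \<le> ?c 1" using entry[of 0 0] 2 by (simp add: hurwitz_entry_def int_coeff_def)
    have c2: "0 < ?c 2" using lead 2 by simp
    have "p = [:?c 0, ?c 1, ?c 2:]"
      using 2 by (intro poly_eqI) (auto simp: coeff_pCons coeff_eq_0 numeral_2_eq_2 split: nat.splits)
    then have "complex_poly p = [:of_real (?c 0), of_real (?c 1), of_real (?c 2):]"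
      by (metis of_real_hom.map_poly_pCons_hom map_poly_0)
    then have re: "?c 0 + ?c 1 * x + ?c 2 * (x\<^sup>2 - y\<^sup>2) = 0" and im: "y * (?c 1 + 2 * ?c 2 * x) = 0"
      using z(1) by (auto simp: z_eq complex_eq_iff power2_eq_square algebra_simps)
    have "0 < ?c 1 + 2 * ?c 2 * x" using c1 c2 x by (intro add_nonneg_pos) auto
    then have "y = 0" using im by simp
    then show False using re c0 c1 c2 x
      by (smt (verit) mult_nonneg_nonneg power2_less_eq_zero_iff zero_le_power2 zero_power2)
  next
    case 3
    have c2: "0 \<le> ?c 2" using entry[of 0 0] 3 by (simp add: hurwitz_entry_def int_coeff_def)
    have c1: "0 \<le> ?c 1" using entry[of 1 1] 3 by (simp add: hurwitz_entry_def int_coeff_def)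
    have c3: "0 < ?c 3" using lead 3 by simp
    have "0 \<le> minor (hurwitz_entry p) 2 (\<lambda>a. a) (\<lambda>b. b)"
      using tn[unfolded totally_nonnegative_iff_minors, rule_format, of 2 "\<lambda>a. a" "\<lambda>b. b"] 3
      by (auto simp: strict_mono_on_def)
    then have m: "0 \<le> ?c 2 * ?c 1 - ?c 0 * ?c 3"
      using 3 by (simp add: minor_2 hurwitz_entry_def int_coeff_def)
    have "p = [:?c 0, ?c 1, ?c 2, ?c 3:]"
      using 3 by (intro poly_eqI)
        (auto simp: coeff_pCons coeff_eq_0 numeral_2_eq_2 numeral_3_eq_3 split: nat.splits)
    then have "complex_poly p = [:of_real (?c 0), of_real (?c 1), of_real (?c 2), of_real (?c 3):]"
      by (metis of_real_hom.map_poly_pCons_hom map_poly_0)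
    then have re: "?c 0 + ?c 1 * x + ?c 2 * (x\<^sup>2 - y\<^sup>2) + ?c 3 * (x ^ 3 - 3 * x * y\<^sup>2) = 0"
      and im: "y * (?c 1 + 2 * ?c 2 * x + ?c 3 * (3 * x\<^sup>2 - y\<^sup>2)) = 0"
      using z(1) by (auto simp: z_eq complex_eq_iff power2_eq_square power3_eq_cube algebra_simps)
    show False
    proof (cases "y = 0")
      case True
      have "0 < ?c 0 + ?c 1 * x + ?c 2 * x\<^sup>2 + ?c 3 * x ^ 3"
        using c0 c1 c2 c3 x by (intro add_pos_nonneg) auto
      then show False using re True by simp
    next
      case False
      then have "?c 1 + 2 * ?c 2 * x + ?c 3 * (3 * x\<^sup>2 - y\<^sup>2) = 0" using im by simp
      then have y2: "?c 3 * y\<^sup>2 = ?c 1 + 2 * ?c 2 * x + 3 * ?c 3 * x\<^sup>2"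
        by (simp add: algebra_simps)
      have "0 = ?c 3 * (?c 0 + ?c 1 * x + ?c 2 * (x\<^sup>2 - y\<^sup>2) + ?c 3 * (x ^ 3 - 3 * x * y\<^sup>2))"
        using re by simp
      also have "\<dots> = ?c 3 * ?c 0 + ?c 3 * ?c 1 * x + ?c 3 * ?c 2 * x\<^sup>2 - ?c 2 * (?c 3 * y\<^sup>2) +
          (?c 3)\<^sup>2 * x ^ 3 - 3 * ?c 3 * x * (?c 3 * y\<^sup>2)"
        by (simp add: algebra_simps power2_eq_square)
      also have "\<dots> = (?c 0 * ?c 3 - ?c 2 * ?c 1) -
          (8 * (?c 3)\<^sup>2 * x ^ 3 + 8 * ?c 2 * ?c 3 * x\<^sup>2 + 2 * ?c 1 * ?c 3 * x + 2 * (?c 2)\<^sup>2 * x)"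
        unfolding y2 by (simp add: algebra_simps power2_eq_square power3_eq_cube)
      finally have "0 = (?c 0 * ?c 3 - ?c 2 * ?c 1) -
          (8 * (?c 3)\<^sup>2 * x ^ 3 + 8 * ?c 2 * ?c 3 * x\<^sup>2 + 2 * ?c 1 * ?c 3 * x + 2 * (?c 2)\<^sup>2 * x)" .
      moreover have "0 < 8 * (?c 3)\<^sup>2 * x ^ 3 + 8 * ?c 2 * ?c 3 * x\<^sup>2 + 2 * ?c 1 * ?c 3 * x + 2 * (?c 2)\<^sup>2 * x"
        using c1 c2 c3 x by (intro add_pos_nonneg) auto
      ultimately show False using m by linarith
    qed
  qed
qed


section \<open>Sharpness of the sector\<close>

lemma sum_predecessor:
  fixes h :: "nat \<Rightarrow> real"
  shows "(\<Sum>c<r. if b = Suc c then h c else 0) = (if 0 < b \<and> b \<le> r then h (b - 1) else 0)"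
proof (cases b)
  case (Suc b')
  then have "(\<Sum>c<r. if b = Suc c then h c else 0) = (\<Sum>c<r. if c = b' then h c else 0)"
    by (intro sum.cong) auto
  then show ?thesis using Suc by auto
qed simp

definition tridiagonal :: "real \<Rightarrow> nat \<Rightarrow> nat \<Rightarrow> real" where
  "tridiagonal x a b = (if a = b then x else if a = Suc b \<or> b = Suc a then 1 else 0)"

lemma sum_times_tridiagonal:
  assumes "b < r"
  shows "(\<Sum>c<r. h c * tridiagonal x c b) =
    (if 0 < b then h (b - 1) else 0) + x * h b + (if Suc b < r then h (Suc b) else 0)"
proof -
  have "h c * tridiagonal x c b = (if b = Suc c then h c else 0) +
      (if c = b then x * h c else 0) + (if c = Suc b then h c else 0)" for c
    by (auto simp: tridiagonal_def)
  then show ?thesis using assms by (simp add: sum.distrib sum_predecessor)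
qed

text \<open>The LU factorization of the matrix with diagonal 2 cos \<theta> and ones next to it has the pivots
  S (i + 2) / S (i + 1), where S i = sin (i \<theta>). In the given range of \<theta> only the last pivot is negative.\<close>

lemma det_tridiagonal_neg:
  assumes r: "0 < r" and th: "real r * \<theta> < pi" "pi < real (r + 1) * \<theta>"
  shows "det (mat r r (\<lambda>(a, b). tridiagonal (2 * cos \<theta>) a b)) < 0"
proof -
  define S where "S i = sin (real i * \<theta>)" for i :: nat
  define L where "L a c = (if c = a then 1 else if a = Suc c then S a / S (Suc a) else 0)" for a c :: nat
  define U where "U a b = (if b = a then S (a + 2) / S (a + 1) else if b = Suc a then 1 else 0)"
    for a b :: nat
  have th0: "0 < \<theta>" using th by (simp add: algebra_simps)
  have pos: "0 < S (Suc i)" if "i < r" for i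
  proof -
    have "real (Suc i) * \<theta> \<le> real r * \<theta>" using that th0 by (intro mult_right_mono) auto
    then have "real (Suc i) * \<theta> < pi" using th by linarith
    then show ?thesis unfolding S_def using th0 by (intro sin_gt_zero) auto
  qed
  have neg: "S (Suc r) < 0"
  proof -
    have "\<theta> \<le> real r * \<theta>" using r th0 mult_right_mono[of 1 "real r" \<theta>] by simp
    then have "real (Suc r) * \<theta> < 2 * pi" using th(1) by (simp add: algebra_simps)
    then show ?thesis unfolding S_def using th(2) by (intro sin_lt_zero) auto
  qed
  have rec: "S i + S (i + 2) = 2 * cos \<theta> * S (i + 1)" for i
  proof -
    have "real i * \<theta> = real (i + 1) * \<theta> - \<theta>" "real (i + 2) * \<theta> = real (i + 1) * \<theta> + \<theta>"
      by (simp_all add: algebra_simps)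
    then show ?thesis unfolding S_def by (simp only: sin_add sin_diff) (simp add: algebra_simps)
  qed
  have "minor (tridiagonal (2 * cos \<theta>)) r (\<lambda>a. a) (\<lambda>b. b) =
      det (mat r r (\<lambda>(a, b). L a b)) * det (mat r r (\<lambda>(a, b). U a b))"
  proof (rule minor_eq_det_product)
    fix a b assume ab: "a < r" "b < r"
    have "L a c * U c b = (if c = a then U c b else 0) +
        (if a = Suc c then S a / S (Suc a) * U c b else 0)" for c
      by (auto simp: L_def)
    then have LU: "(\<Sum>c<r. L a c * U c b) =
        U a b + (if 0 < a then S a / S (Suc a) * U (a - 1) b else 0)"
      using ab by (simp add: sum.distrib sum_predecessor)
    show "tridiagonal (2 * cos \<theta>) a b = (\<Sum>c<r. L a c * U c b)"
    proof (cases a)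
      case 0
      have "S 0 = 0" by (simp add: S_def)
      then have "S 2 / S 1 = 2 * cos \<theta>" using rec[of 0] pos[OF r] by (simp add: field_simps numeral_2_eq_2)
      then show ?thesis unfolding LU by (simp add: 0 tridiagonal_def U_def numeral_2_eq_2)
    next
      case (Suc a')
      have p: "S (Suc a') \<noteq> 0" "S (Suc (Suc a')) \<noteq> 0" using pos[of a'] pos[of a] ab Suc by auto
      have "S (a + 2) / S (a + 1) + S a / S (Suc a) = 2 * cos \<theta>"
        using rec[of a] p Suc by (simp add: field_simps)
      then show ?thesis unfolding LU using p Suc by (auto simp: tridiagonal_def U_def)
    qed
  qed
  also have "det (mat r r (\<lambda>(a, b). L a b)) = 1"
    by (subst det_lower_triangular[of r]) (auto simp: L_def prod_list_diag_prod)
  also have "det (mat r r (\<lambda>(a, b). U a b)) = (\<Prod>i<r. S (i + 2) / S (i + 1))"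
    by (subst det_upper_triangular[of _ r])
      (auto simp: U_def prod_list_diag_prod upper_triangular_def atLeast0LessThan)
  also have "1 * (\<Prod>i<r. S (i + 2) / S (i + 1)) < 0"
  proof -
    obtain k where k: "r = Suc k" using r by (cases r) auto
    have "0 < (\<Prod>i<k. S (i + 2) / S (i + 1))"
      using pos k by (intro prod_pos) (auto intro!: divide_pos_pos)
    moreover have "S (k + 2) / S (k + 1) < 0"
      using neg pos[of k] k by (auto intro!: divide_neg_pos)
    ultimately show ?thesis unfolding k prod.lessThan_Suc mult_1 by (rule mult_pos_neg)
  qed
  finally show ?thesis unfolding minor_def .
qed

text \<open>Multiplying by the even quartic multiplies the Hurwitz matrix from the right by a band matrix. With
  the first column left out, the band restricts to a square tridiagonal matrix.\<close>

lemma hurwitz_entry_quartic_factor: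
  fixes q :: "real poly" and x :: real
  assumes "q \<noteq> 0"
  defines "p \<equiv> square_subst [:1, x, 1:] * q"
  assumes i: "i < degree q + 4" and b: "b < degree q + 2"
  shows "hurwitz_entry p i (Suc b) =
    (\<Sum>c<degree q + 2. hurwitz_entry q i c * tridiagonal x c b)"
proof -
  have F: "square_subst [:1, x, 1:] = [:1, 0, x, 0, 1:]" by (simp add: pcompose_pCons)
  have deg: "degree p = degree q + 4"
    using assms(1) unfolding p_def by (subst degree_square_subst_times) auto
  have "p = q + Polynomial.smult x (pCons 0 (pCons 0 q)) +
      pCons 0 (pCons 0 (pCons 0 (pCons 0 q)))"
    unfolding p_def F by simp
  then have p: "int_coeff p k = int_coeff q k + x * int_coeff q (k - 1 - 1) +
      int_coeff q (k - 1 - 1 - 1 - 1)" for k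
    by (simp only: int_coeff_add int_coeff_smult int_coeff_pCons_0)
  have "hurwitz_entry p i (Suc b) = int_coeff q (int (degree q) + int i + 1 - 2 * int b) +
      x * hurwitz_entry q i b + hurwitz_entry q i (Suc b)"
    unfolding hurwitz_entry_def[of p] p deg by (simp add: hurwitz_entry_def algebra_simps)
  also have "int_coeff q (int (degree q) + int i + 1 - 2 * int b) =
      (if 0 < b then hurwitz_entry q i (b - 1) else 0)"
  proof (cases b)
    case 0
    then show ?thesis by (simp add: int_coeff_eq_0)
  next
    case (Suc b')
    then show ?thesis by (simp add: hurwitz_entry_def algebra_simps)
  qed
  also have "hurwitz_entry q i (Suc b) =
      (if Suc b < degree q + 2 then hurwitz_entry q i (Suc b) else 0)"
    using i b by (auto simp: hurwitz_entry_def int_coeff_neg)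
  finally show ?thesis unfolding sum_times_tridiagonal[OF b] .
qed

text \<open>The minor in question has rows 1, 3, 4, 5, ... and columns 1, 2, 3, ...; it is the product of a
  minor of the Hurwitz matrix of q, positive for this choice of rows, and of the negative
  tridiagonal determinant.\<close>

lemma quartic_factor_not_totally_nonnegative:
  assumes q: "hurwitz_stable q"
    and th: "real (degree q + 2) * \<theta> < pi" "pi < real (degree q + 3) * \<theta>"
  shows "\<not> totally_nonnegative (finite_hurwitz_matrix (square_subst [:1, 2 * cos \<theta>, 1:] * q))"
proof -
  let ?p = "square_subst [:1, 2 * cos \<theta>, 1:] * q"
  let ?r = "degree q + 2"
  define f where "f a = (if a = 0 then 1 else a + 2)" for a :: nat
  have q0: "q \<noteq> 0" using q by (auto simp: hurwitz_stable_def)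
  have deg: "degree ?p = degree q + 4"
    using q0 by (subst degree_square_subst_times) auto
  have mono: "strict_mono_on {..<?r} f" "strict_mono_on {..<?r} Suc"
    by (auto simp: strict_mono_on_def f_def)
  have "minor (hurwitz_entry ?p) ?r f Suc =
      det (mat ?r ?r (\<lambda>(a, b). hurwitz_entry q (f a) b)) *
      det (mat ?r ?r (\<lambda>(a, b). tridiagonal (2 * cos \<theta>) a b))"
    by (rule minor_eq_det_product, rule hurwitz_entry_quartic_factor[OF q0]) (auto simp: f_def)
  moreover have "0 < det (mat ?r ?r (\<lambda>(a, b). hurwitz_entry q (f a) b))"
    using hurwitz_minor_pos[OF q refl mono(1)] unfolding minor_def by (auto simp: f_def)
  moreover have "det (mat ?r ?r (\<lambda>(a, b). tridiagonal (2 * cos \<theta>) a b)) < 0"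
    using th by (intro det_tridiagonal_neg) (auto simp: algebra_simps)
  ultimately have "minor (hurwitz_entry ?p) ?r f Suc < 0" by (simp add: mult_pos_neg)
  moreover have "f ` {..<?r} \<subseteq> {..<degree ?p}" "Suc ` {..<?r} \<subseteq> {..<degree ?p}"
    unfolding deg by (auto simp: f_def)
  ultimately show ?thesis
    unfolding totally_nonnegative_iff_minors using mono by (metis not_less)
qed

lemma quartic_no_zeros_in_sector:
  assumes th: "0 < \<theta>" "\<theta> < pi" and z: "\<bar>Arg z\<bar> < (pi - \<theta>) / 2"
  shows "poly (complex_poly (square_subst [:1, 2 * cos \<theta>, 1:])) z \<noteq> 0"
proof
  assume "poly (complex_poly (square_subst [:1, 2 * cos \<theta>, 1:])) z = 0"
  then have zero: "(z\<^sup>2)\<^sup>2 + 2 * of_real (cos \<theta>) * z\<^sup>2 + 1 = 0"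
    by (simp add: pcompose_pCons of_real_hom.map_poly_pCons_hom power2_eq_square algebra_simps)
  have unit: "(complex_of_real (cos \<theta>))\<^sup>2 + (of_real (sin \<theta>))\<^sup>2 = 1"
    by (simp flip: of_real_power of_real_add)
  have "(z\<^sup>2 + of_real (cos \<theta>) - \<i> * of_real (sin \<theta>)) * (z\<^sup>2 + of_real (cos \<theta>) + \<i> * of_real (sin \<theta>)) =
      (z\<^sup>2)\<^sup>2 + 2 * of_real (cos \<theta>) * z\<^sup>2 + ((of_real (cos \<theta>))\<^sup>2 + (of_real (sin \<theta>))\<^sup>2)"
    by (simp add: power2_eq_square algebra_simps)
  then have "z\<^sup>2 + of_real (cos \<theta>) - \<i> * of_real (sin \<theta>) = 0 \<or>
      z\<^sup>2 + of_real (cos \<theta>) + \<i> * of_real (sin \<theta>) = 0"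
    unfolding unit zero by simp
  then have re: "Re (z\<^sup>2) = - cos \<theta>" and im: "(Im (z\<^sup>2))\<^sup>2 = (sin \<theta>)\<^sup>2"
    by (auto simp: complex_eq_iff power2_eq_iff eq_neg_iff_add_eq_0)
  have "(cmod (z\<^sup>2))\<^sup>2 = 1" unfolding cmod_power2 re im by simp
  then have "(cmod z)\<^sup>2 = 1 \<or> (cmod z)\<^sup>2 = - 1" by (simp only: norm_power power2_eq_1_iff)
  then have "(cmod z)\<^sup>2 = 1" using zero_le_power2[of "cmod z"] by linarith
  then have "cos (2 * \<bar>Arg z\<bar>) = cos (pi - \<theta>)"
    using re Re_square_eq_cos_double_Arg[of z] by (simp add: cos_diff)
  moreover have "cos (pi - \<theta>) < cos (2 * \<bar>Arg z\<bar>)"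
    using th z by (intro cos_monotone_0_pi) auto
  ultimately show False by simp
qed

text \<open>The witness has four simple zeros on the unit circle, at the angles \<plusminus>(\<pi> - \<theta>) / 2 and opposite to
  them, and otherwise only the zero -1.\<close>

lemma sector_constant_sharp:
  fixes n :: nat and \<beta> :: real
  assumes n: "4 \<le> n" and \<beta>: "\<beta> < pi / 2 * ((real n - 2) / (real n - 1))"
  obtains p :: "real poly" where "degree p = n" "0 < Polynomial.coeff p n" "0 < Polynomial.coeff p 0"
    "no_zeros_in_sector p \<beta>" "reflection_property p"
    "\<not> totally_nonnegative (finite_hurwitz_matrix p)"
proof -
  have n': "real n \<ge> 4" using n by simp
  have "pi / (real n - 1) < pi - 2 * \<beta>"
    using \<beta> n' by (simp add: field_simps)
  moreover have "pi / (real n - 1) < pi / (real n - 2)"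
    using n' by (simp add: frac_less2)
  ultimately have "pi / (real n - 1) < min (pi - 2 * \<beta>) (pi / (real n - 2))" by simp
  \<comment> \<open>The first bound keeps the zeros out of the sector of half-angle \<beta>; the second
    keeps all pivots but the last positive.\<close>
  then obtain \<theta> where th: "pi / (real n - 1) < \<theta>" "\<theta> < min (pi - 2 * \<beta>) (pi / (real n - 2))"
    using dense by blast
  have th0: "0 < \<theta>" using th(1) n' by (smt (verit) divide_pos_pos pi_gt_zero)
  have th1: "pi < (real n - 1) * \<theta>" "(real n - 2) * \<theta> < pi"
    using th n' by (simp_all add: field_simps)
  have "1 * \<theta> \<le> (real n - 2) * \<theta>" using n' th0 by (intro mult_right_mono) auto
  then have th_pi: "\<theta> < pi" using th1(2) by simp
  define m where "m = n - 4"
  define q :: "real poly" where "q = [:1, 1:] ^ m"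
  define p where "p = square_subst [:1, 2 * cos \<theta>, 1:] * q"
  have degq: "degree q = m" unfolding q_def by (simp add: degree_power_eq)
  have leadq: "lead_coeff q = 1" unfolding q_def by (simp add: lead_coeff_power)
  have q0: "q \<noteq> 0" unfolding q_def by simp
  have qz: "poly (complex_poly q) z = (1 + z) ^ m" for z
    unfolding q_def by (simp add: complex_poly_hom.hom_power of_real_hom.map_poly_pCons_hom poly_power)
  have q: "hurwitz_stable q"
    unfolding hurwitz_stable_def leadq qz by (auto simp: add_eq_0_iff)
  have deg: "degree p = n"
    unfolding p_def using q0 degq n by (subst degree_square_subst_times) (auto simp: m_def)
  have "lead_coeff p = 1"
    unfolding p_def lead_coeff_mult lead_coeff_square_subst leadq by simp
  then have 1: "0 < Polynomial.coeff p n" using deg by simp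
  have "Polynomial.coeff q 0 = 1" unfolding q_def by (simp add: coeff_0_power)
  then have 2: "0 < Polynomial.coeff p 0"
    unfolding p_def by (simp add: coeff_mult_0 coeff_square_subst)
  have 3: "no_zeros_in_sector p \<beta>"
    unfolding no_zeros_in_sector_def
  proof (intro allI impI)
    fix z assume "z \<noteq> 0 \<and> \<bar>Arg z\<bar> < \<beta>"
    then have z: "z \<noteq> 0" "\<bar>Arg z\<bar> < (pi - \<theta>) / 2" using th(2) by auto
    have "cos (pi / 2) < cos \<bar>Arg z\<bar>" using z th0 by (intro cos_monotone_0_pi) auto
    then have "0 < Re z" using cos_Arg[OF z(1)] z(1) by (simp add: zero_less_divide_iff)
    then have "poly (complex_poly q) z \<noteq> 0" using q unfolding hurwitz_stable_def by force
    then show "poly (complex_poly p) z \<noteq> 0"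
      using quartic_no_zeros_in_sector[OF th0 th_pi z(2)]
      unfolding p_def complex_poly_hom.hom_mult poly_mult mult_eq_0_iff by blast
  qed
  have "Polynomial.order l (complex_poly q) = 0" if "0 < Re l" for l
    by (rule order_0I) (use q that in \<open>force simp: hurwitz_stable_def\<close>)
  then have "reflection_property q" unfolding reflection_property_def by simp
  moreover have "p \<noteq> 0" using 2 by auto
  ultimately have 4: "reflection_property p"
    unfolding p_def using reflection_property_even_factor_iff by blast
  have 5: "\<not> totally_nonnegative (finite_hurwitz_matrix p)"
    unfolding p_def
    by (rule quartic_factor_not_totally_nonnegative[OF q])
      (use th1 n in \<open>simp_all add: degq m_def of_nat_diff algebra_simps\<close>)
  show thesis using that[OF deg 1 2 3 4 5] .
qed

theorem theorem2p3:
  shows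
    "(\<forall>(n::nat) (p::real poly).
        n \<ge> 4 \<and> degree p = n \<and> Polynomial.coeff p n > 0 \<and> Polynomial.coeff p 0 > 0 \<and>
        no_zeros_in_sector p (pi / 2 * ((real n - 2) / (real n - 1))) \<and>
        reflection_property p
        \<longrightarrow> totally_nonnegative (finite_hurwitz_matrix p)) \<and>
     (\<forall>(n::nat) (\<beta>::real).
        n \<ge> 4 \<and> \<beta> < pi / 2 * ((real n - 2) / (real n - 1))
        \<longrightarrow> (\<exists>p::real poly.
              degree p = n \<and> Polynomial.coeff p n > 0 \<and> Polynomial.coeff p 0 > 0 \<and>
              no_zeros_in_sector p \<beta> \<and> reflection_property p \<and>
              \<not> totally_nonnegative (finite_hurwitz_matrix p))) \<and>
     (\<forall>(n::nat) (p::real poly).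
        1 \<le> n \<and> n \<le> 3 \<and> degree p = n \<and> Polynomial.coeff p n > 0 \<and> Polynomial.coeff p 0 > 0
        \<longrightarrow> (quasi_stable p \<longleftrightarrow> totally_nonnegative (finite_hurwitz_matrix p)))"
proof (intro conjI allI impI; elim conjE)
  fix n :: nat and p :: "real poly"
  assume "n \<ge> 4" "degree p = n" "Polynomial.coeff p n > 0" "Polynomial.coeff p 0 > 0"
    "no_zeros_in_sector p (pi / 2 * ((real n - 2) / (real n - 1)))" "reflection_property p"
  then show "totally_nonnegative (finite_hurwitz_matrix p)"
    by (intro sector_imp_totally_nonnegative) auto
next
  fix n :: nat and \<beta> :: real
  assume "n \<ge> 4" "\<beta> < pi / 2 * ((real n - 2) / (real n - 1))"
  from sector_constant_sharp[OF this] show "\<exists>p::real poly.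
      degree p = n \<and> Polynomial.coeff p n > 0 \<and> Polynomial.coeff p 0 > 0 \<and>
      no_zeros_in_sector p \<beta> \<and> reflection_property p \<and>
      \<not> totally_nonnegative (finite_hurwitz_matrix p)" by metis
next
  fix n :: nat and p :: "real poly"
  assume "1 \<le> n" "n \<le> 3" "degree p = n" "Polynomial.coeff p n > 0" "Polynomial.coeff p 0 > 0"
  then show "quasi_stable p \<longleftrightarrow> totally_nonnegative (finite_hurwitz_matrix p)"
    using quasi_stable_imp_totally_nonnegative[of p] totally_nonnegative_imp_quasi_stable[of p]
    by auto
qed

end
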